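(* Let $(X,\mathcal{B},\mu)$ be a standard Borel probability space, let $\lambda$ be a Borel probability measure on $\mathrm{Aut}(X,\mu)$ (not assumed symmetric), write $\rho=\rho^+(\lambda)$, let $0<\kappa\le 1$ with $\kappa>\rho$, and let $$\lambda=\kappa\lambda_{1}+(1-\kappa)\lambda_{2}$$ where $\lambda_1,\lambda_2$ are Borel probability measures on $\mathrm{Aut}(X,\mu)$ (not assumed symmetric). Then: (1) every $\lambda_{1}$-invariant Borel subset $Y\in\mathcal{B}$ of positive measure satisfies $$\mu(Y)\geq\frac{\kappa-\rho}{1-\rho};$$ (2) for every Borel subset $Y\in\mathcal{B}$ with $0<\mu(Y)\leq\frac{1}{2}\frac{\kappa-\rho}{1-\rho}$ we have $$\frac{e_{\lambda_{1}}(Y)}{\mu(Y)}\geq\frac{1}{2}\frac{\kappa-\rho}{\kappa};$$ (3) in particular, one can decompose $X=\bigcup_{i=1}^{n}X_{i}$ with $n\leq\frac{1-\rho}{\kappa-\rho}$, where the $X_{i}$ are $\lambda_{1}$-ergodic Borel subsets of positive measure, and $\lambda_{1}$ on $X_{i}$ has spectral gap for $1\leq i\leq n$.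
   Context: $\mathrm{Aut}(X,\mu)$ is the Polish group of $\mu$-preserving Borel isomorphisms of $(X,\mathcal{B},\mu)$, acting on $X$ from the right. $L^2(X)$ is the space of real square integrable functions, $L_0^2(X)$ the subspace of functions with zero integral. For a Borel probability measure $\lambda$ on $\mathrm{Aut}(X,\mu)$, $M_\lambda$ is the averaging operator $(fM_\lambda)(x)=\int f(xa)\,d\lambda(a)$ on $L^2(X)$, and $$\rho^+(\lambda)=\rho^+(X,\mathcal{B},\mu,\lambda)=\sup_{0\ne f\in L_0^2(X)}\frac{\langle fM_\lambda,f\rangle}{\langle f,f\rangle}.$$ For $Y\in\mathcal{B}$ let $e_\lambda(Y)=\int \mu(Ya\setminus Y)\,d\lambda(a)$. A Borel set $Y$ is $\lambda$-invariant if $e_\lambda(Y)=0$. When $Y$ is $\lambda$-invariant and $\mu(Y)>0$, $\lambda$ restricts naturally to a measure on $\mathrm{Aut}(Y,\frac{1}{\mu(Y)}\mu)$. $Y$ is $\lambda$-ergodic if $Y$ is $\lambda$-invariant and every $\lambda$-invariant Borel subset $Z\subseteq Y$ satisfies $\mu(Z)=0$ or $\mu(Y\setminus Z)=0$. For a $\lambda$-invariant $Y$ of positive measure, "$\lambda$ on $Y$ has spectral gap" means $\rho^+(Y,\mathcal{B}|_Y,\mu/\mu(Y),\lambda)<1$ for the restricted measure. The decomposition in (3) is into pairwise disjoint sets, up to null sets. *)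

theory Defs
  imports "HOL-Probability.Probability"
begin

definition standard_borel :: "'a measure \<Rightarrow> bool" where
  "standard_borel M \<longleftrightarrow>
     (\<exists>T. topspace T = space M \<and> completely_metrizable_space T \<and> second_countable T \<and>
          sets M = sigma_sets (space M) {U. openin T U})"

definition standard_borel_prob_space :: "'a measure \<Rightarrow> bool" where
  "standard_borel_prob_space M \<longleftrightarrow> prob_space M \<and> standard_borel M"


section \<open>The automorphism group with its weak topology\<close>

definition borel_isos :: "'a measure \<Rightarrow> ('a \<Rightarrow> 'a) set" where
  "borel_isos M =
     {t. t \<in> measurable M M \<and> bij_betw t (space M) (space M) \<and>
         inv_into (space M) t \<in> measurable M M \<and> distr M M t = M}"

definition ae_equal :: "'a measure \<Rightarrow> (('a \<Rightarrow> 'a) \<times> ('a \<Rightarrow> 'a)) set" where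
  "ae_equal M = {(s, t). s \<in> borel_isos M \<and> t \<in> borel_isos M \<and> (AE x in M. s x = t x)}"

text \<open>As usual for the Polish group of automorphisms of a probability space, isomorphisms that
  agree almost everywhere are identified: a point of \<open>Aut M\<close> is an equivalence class.\<close>

definition Aut :: "'a measure \<Rightarrow> ('a \<Rightarrow> 'a) set set" where
  "Aut M = borel_isos M // ae_equal M"

text \<open>\<open>rep a x\<close> stands for \<open>x a\<close> and \<open>rep a ` Y\<close> for \<open>Y a\<close>. Every quantity below that mentions
  \<open>rep a\<close> is unchanged if another member of the class \<open>a\<close> is chosen.\<close>

definition rep :: "('a \<Rightarrow> 'a) set \<Rightarrow> 'a \<Rightarrow> 'a" where
  "rep a = (SOME t. t \<in> a)"

text \<open>The weak topology: the coarsest one for which all maps \<open>a \<mapsto> Y a\<close> into the measure algebra,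
  with its metric \<open>(A, B) \<mapsto> \<mu> (A \<triangle> B)\<close>, are continuous. The subbasis consists of the preimages of
  the open balls.\<close>

definition weak_topology :: "'a measure \<Rightarrow> ('a \<Rightarrow> 'a) set topology" where
  "weak_topology M =
     topology_generated_by
       {{a \<in> Aut M. measure M (sym_diff (rep a ` Y) Z) < \<epsilon>} | Y Z \<epsilon>.
          Y \<in> sets M \<and> Z \<in> sets M \<and> \<epsilon> > 0}"

definition Aut_borel :: "'a measure \<Rightarrow> ('a \<Rightarrow> 'a) set measure" where
  "Aut_borel M = sigma (Aut M) {U. openin (weak_topology M) U}"

definition borel_prob_on_Aut :: "'a measure \<Rightarrow> ('a \<Rightarrow> 'a) set measure \<Rightarrow> bool" where
  "borel_prob_on_Aut M \<Lambda> \<longleftrightarrow> prob_space \<Lambda> \<and> sets \<Lambda> = sets (Aut_borel M)"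

lemma equiv_ae_equal: "equiv (borel_isos M) (ae_equal M)"
  by (rule equivI) (auto simp: refl_on_def sym_def trans_def ae_equal_def elim: AE_mp)

lemma topspace_weak_topology: "topspace (weak_topology M) = Aut M"
proof -
  let ?S = "{{a \<in> Aut M. measure M (sym_diff (rep a ` Y) Z) < \<epsilon>} | Y Z \<epsilon>.
               Y \<in> sets M \<and> Z \<in> sets M \<and> \<epsilon> > 0}"
  have "Aut M = {a \<in> Aut M. measure M (sym_diff (rep a ` {}) {}) < 1}"
    by simp
  then have "Aut M \<in> ?S"
    using sets.empty_sets zero_less_one by blast
  moreover have "\<Union>?S \<subseteq> Aut M"
    by auto
  ultimately show ?thesis
    unfolding weak_topology_def topology_generated_by_topspace by blast
qed

lemma space_Aut_borel: "space (Aut_borel M) = Aut M"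
  unfolding Aut_borel_def
proof (rule space_measure_of)
  show "{U. openin (weak_topology M) U} \<subseteq> Pow (Aut M)"
    using openin_subset topspace_weak_topology by blast
qed


section \<open>The averaging operator and the upper spectral bound\<close>

definition L2 :: "'a measure \<Rightarrow> ('a \<Rightarrow> real) set" where
  "L2 M = {f \<in> borel_measurable M. integrable M (\<lambda>x. (f x)\<^sup>2)}"

definition L2_zero :: "'a measure \<Rightarrow> ('a \<Rightarrow> real) set" where
  "L2_zero M = {f \<in> L2 M. (\<integral>x. f x \<partial>M) = 0}"

definition inner_L2 :: "'a measure \<Rightarrow> ('a \<Rightarrow> real) \<Rightarrow> ('a \<Rightarrow> real) \<Rightarrow> real" where
  "inner_L2 M f g = (\<integral>x. f x * g x \<partial>M)"

text \<open>Since the points of \<open>Aut M\<close> are classes modulo null sets, \<open>x \<mapsto> f (x a)\<close> is determined only as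
  an element of \<open>L\<^sup>2\<close>, and \<open>\<integral> f (x a) d\<Lambda>(a)\<close> is the integral of an \<open>L\<^sup>2\<close>-valued function,
  taken in the weak sense. It determines \<open>avg_op M \<Lambda> f\<close> up to a null set.\<close>

definition avg_op :: "'a measure \<Rightarrow> ('a \<Rightarrow> 'a) set measure \<Rightarrow> ('a \<Rightarrow> real) \<Rightarrow> ('a \<Rightarrow> real)" where
  "avg_op M \<Lambda> f =
     (SOME h. h \<in> L2 M \<and>
        (\<forall>g \<in> L2 M. inner_L2 M h g = (\<integral>a. inner_L2 M (\<lambda>x. f (rep a x)) g \<partial>\<Lambda>)))"

definition rayleigh_quotients :: "'a measure \<Rightarrow> ('a \<Rightarrow> 'a) set measure \<Rightarrow> real set" where
  "rayleigh_quotients M \<Lambda> =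
     {inner_L2 M (avg_op M \<Lambda> f) f / inner_L2 M f f | f.
        f \<in> L2_zero M \<and> \<not> (AE x in M. f x = 0)}"

text \<open>The quotients lie in \<open>[-1, 1]\<close> by the Cauchy--Schwarz inequality. If \<open>M\<close> is a point mass up to
  null sets, there are no quotients; the supremum of the empty subset of \<open>[-1, 1]\<close> is \<open>-1\<close>.\<close>

definition rho_plus :: "'a measure \<Rightarrow> ('a \<Rightarrow> 'a) set measure \<Rightarrow> real" where
  "rho_plus M \<Lambda> =
     (if rayleigh_quotients M \<Lambda> = {} then -1 else Sup (rayleigh_quotients M \<Lambda>))"


section \<open>Expansion, invariance, ergodicity and spectral gap\<close>

definition expansion :: "'a measure \<Rightarrow> ('a \<Rightarrow> 'a) set measure \<Rightarrow> 'a set \<Rightarrow> real" where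
  "expansion M \<Lambda> Y = (\<integral>a. measure M (rep a ` Y - Y) \<partial>\<Lambda>)"

definition invariant_set :: "'a measure \<Rightarrow> ('a \<Rightarrow> 'a) set measure \<Rightarrow> 'a set \<Rightarrow> bool" where
  "invariant_set M \<Lambda> Y \<longleftrightarrow> Y \<in> sets M \<and> expansion M \<Lambda> Y = 0"

definition ergodic_set :: "'a measure \<Rightarrow> ('a \<Rightarrow> 'a) set measure \<Rightarrow> 'a set \<Rightarrow> bool" where
  "ergodic_set M \<Lambda> Y \<longleftrightarrow>
     invariant_set M \<Lambda> Y \<and>
     (\<forall>Z. invariant_set M \<Lambda> Z \<and> Z \<subseteq> Y \<longrightarrow> measure M Z = 0 \<or> measure M (Y - Z) = 0)"

definition normalized_restriction :: "'a measure \<Rightarrow> 'a set \<Rightarrow> 'a measure" where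
  "normalized_restriction M Y = scale_measure (1 / emeasure M Y) (restrict_space M Y)"

text \<open>If \<open>Y a = Y\<close> up to a null set, then some Borel isomorphisms of \<open>Y\<close> agree almost everywhere on
  \<open>Y\<close> with \<open>a\<close>, and together they form one class in \<open>Aut (normalized_restriction M Y)\<close>.\<close>

definition restrict_aut :: "'a measure \<Rightarrow> 'a set \<Rightarrow> ('a \<Rightarrow> 'a) set \<Rightarrow> ('a \<Rightarrow> 'a) set" where
  "restrict_aut M Y a =
     {t \<in> borel_isos (normalized_restriction M Y).
        AE y in normalized_restriction M Y. t y = rep a y}"

text \<open>For invariant \<open>Y\<close>, the set of \<open>a\<close> that preserve \<open>Y\<close> up to a null set has full \<open>\<Lambda>\<close>-measure; the
  restriction of \<open>\<Lambda>\<close> is the push-forward from this set.\<close>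

definition restrict_law ::
    "'a measure \<Rightarrow> 'a set \<Rightarrow> ('a \<Rightarrow> 'a) set measure \<Rightarrow> ('a \<Rightarrow> 'a) set measure" where
  "restrict_law M Y \<Lambda> =
     distr (restrict_space \<Lambda> {a \<in> Aut M. measure M (rep a ` Y - Y) = 0})
       (Aut_borel (normalized_restriction M Y)) (restrict_aut M Y)"

definition spectral_gap_on :: "'a measure \<Rightarrow> ('a \<Rightarrow> 'a) set measure \<Rightarrow> 'a set \<Rightarrow> bool" where
  "spectral_gap_on M \<Lambda> Y \<longleftrightarrow>
     rho_plus (normalized_restriction M Y) (restrict_law M Y \<Lambda>) < 1"

end

theory Submission
  imports Defs "HOL-Library.Ramsey"
begin

text \<open>Testing the definition of \<open>\<rho>\<close> on \<open>1\<^sub>A - \<mu> A\<close> gives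
  \<open>(1 - \<rho>) \<mu> A (1 - \<mu> A) \<le> e A \<le> \<kappa> e\<^sub>1 A + (1 - \<kappa>) \<mu> A\<close>, hence
  \<open>\<mu> A ((\<kappa> - \<rho>) - (1 - \<rho>) \<mu> A) \<le> \<kappa> e\<^sub>1 A\<close>, where \<open>e\<close> and \<open>e\<^sub>1\<close> are the expansions for \<open>\<Lambda>\<close>
  and \<open>\<Lambda>\<^sub>1\<close>. This is (1) and (2), and by (1) splitting \<open>X\<close> into invariant sets stops after finitely
  many steps. For the spectral gap on an ergodic piece, small sets expand by (2). A sequence of
  almost invariant sets of medium measure would, after passing to almost minimal ones, converge to
  an invariant set, against ergodicity. So all sets of at most half measure expand uniformly, and
  Cheeger's inequality applies.\<close>

subsection \<open>Automorphisms\<close>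

text \<open>Automorphisms act isometrically on L2, so the defect
  \<open>inner_L2 M f f - corr f\<close> is half the mean over \<open>a\<close> of the squared norm
  of \<open>f (x a) - f x\<close>. Working with this Dirichlet form covers laws that are not
  symmetric, whose averaging operator is not self-adjoint. The obstacle that shapes the proof is
  that a point of \<open>Aut M\<close> is a class and \<open>rep\<close> an arbitrary choice in it:
  \<open>(a, x) \<mapsto> rep a x\<close> need not be jointly measurable, so integrals over
  \<open>M\<close> and over the law cannot be exchanged freely. Measurability in \<open>a\<close>
  starts from the measures of symmetric differences, and everything else is reduced to them; hence
  averages are obtained by duality, and level sets are summed over finitely many levels. Restriction
  to an ergodic piece is carried out for expansions of sets, never for operators: the measure and
  the expansion of a subset are both divided by the measure of the piece, so the linear bound for
  small sets survives with the same constants, and the spectral gap is rebuilt there from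
  sets.\<close>

lemma rep_in_class: "a \<in> Aut M \<Longrightarrow> rep a \<in> a"
  unfolding Aut_def rep_def
  by (metis equiv_ae_equal in_quotient_imp_non_empty some_in_eq)

lemma rep_borel_isos: "a \<in> Aut M \<Longrightarrow> rep a \<in> borel_isos M"
  using rep_in_class[of a M] unfolding Aut_def
  by (meson equiv_ae_equal in_quotient_imp_subset subsetD)

lemma
  assumes "t \<in> borel_isos M"
  shows iso_measurable: "t \<in> M \<rightarrow>\<^sub>M M"
    and iso_bij: "bij_betw t (space M) (space M)"
    and iso_inj: "inj_on t (space M)"
    and iso_inv_measurable: "inv_into (space M) t \<in> M \<rightarrow>\<^sub>M M"
    and iso_distr: "distr M M t = M"
  using assms by (auto simp: borel_isos_def bij_betw_def)

lemma iso_emeasure_vimage: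
  assumes "t \<in> borel_isos M" "A \<in> sets M"
  shows "emeasure M (t -` A \<inter> space M) = emeasure M A"
  by (metis assms emeasure_distr iso_distr iso_measurable)

lemma iso_image_sets:
  assumes t: "t \<in> borel_isos M" and A: "A \<in> sets M"
  shows "t ` A \<in> sets M"
proof -
  have "t ` A = inv_into (space M) t -` A \<inter> space M"
  proof (intro equalityI subsetI)
    fix y assume "y \<in> t ` A"
    then obtain x where x: "x \<in> A" "y = t x" by auto
    then have "x \<in> space M" using sets.sets_into_space[OF A] by auto
    then show "y \<in> inv_into (space M) t -` A \<inter> space M"
      using x iso_inj[OF t] iso_bij[OF t] by (auto simp: bij_betw_def)
  next
    fix y assume y: "y \<in> inv_into (space M) t -` A \<inter> space M"
    then have "t (inv_into (space M) t y) = y"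
      using iso_bij[OF t] by (auto simp: bij_betw_def f_inv_into_f)
    then show "y \<in> t ` A" using y by (metis IntD1 imageI vimageE)
  qed
  then show ?thesis using measurable_sets[OF iso_inv_measurable[OF t] A] by simp
qed

lemma sets_Collect_iso:
  assumes t: "t \<in> borel_isos M" and [measurable]: "A \<in> sets M" "B \<in> sets M"
  shows "{x \<in> A. t x \<in> B} \<in> sets M"
proof -
  note iso_measurable[OF t, measurable]
  have "{x \<in> A. t x \<in> B} = {x \<in> space M. x \<in> A \<and> t x \<in> B}"
    using sets.sets_into_space[of A M] by auto
  then show ?thesis by simp
qed

context prob_space
begin

lemma iso_measure_vimage:
  assumes "t \<in> borel_isos M" "A \<in> sets M"
  shows "prob {x \<in> space M. t x \<in> A} = prob A"
  using iso_emeasure_vimage[OF assms]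
  by (simp add: measure_def vimage_def Int_def conj_commute)

text \<open>Pulling back along the measure preserving \<open>t\<close> turns an image into a set
  that only asks where a point goes. Later estimates are made for such sets.\<close>

lemma iso_measure_image_Int:
  assumes t: "t \<in> borel_isos M" and A: "A \<in> sets M" and B: "B \<in> sets M"
  shows "prob (t ` A \<inter> B) = prob {x \<in> A. t x \<in> B}"
proof -
  have "{x \<in> space M. t x \<in> t ` A \<inter> B} = {x \<in> A. t x \<in> B}"
    using sets.sets_into_space[OF A] inj_onD[OF iso_inj[OF t]] by blast
  then show ?thesis
    using iso_measure_vimage[OF t, of "t ` A \<inter> B"] iso_image_sets[OF t A] B by auto
qed

lemma iso_measure_image:
  assumes t: "t \<in> borel_isos M" and A: "A \<in> sets M"
  shows "prob (t ` A) = prob A"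
proof -
  have "t ` A \<subseteq> space M"
    using iso_image_sets[OF t A] sets.sets_into_space by blast
  moreover from this have "{x \<in> A. t x \<in> space M} = A" by auto
  ultimately show ?thesis
    using iso_measure_image_Int[OF t A sets.top] by (simp add: Int_absorb2)
qed

lemma iso_measure_image_Diff:
  assumes t: "t \<in> borel_isos M" and A: "A \<in> sets M" and B: "B \<in> sets M"
  shows "prob (t ` A - B) = prob A - prob {x \<in> A. t x \<in> B}"
  using finite_measure_Diff'[OF iso_image_sets[OF t A] B]
    iso_measure_image[OF t A] iso_measure_image_Int[OF t A B] by simp

text \<open>The left side is what the weak topology controls, the last measure on the right is what
  integrals against indicators produce; each determines the other.\<close>

lemma iso_measure_sym_diff:
  assumes t: "t \<in> borel_isos M" and A: "A \<in> sets M" and B: "B \<in> sets M"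
  shows "prob (sym_diff (t ` A) B) = prob A + prob B - 2 * prob {x \<in> A. t x \<in> B}"
proof -
  have tA: "t ` A \<in> sets M" by (rule iso_image_sets[OF t A])
  have "prob (sym_diff (t ` A) B) = prob (t ` A - B) + prob (B - t ` A)"
    using tA B by (intro finite_measure_Union) auto
  also have "prob (B - t ` A) = prob B - prob (t ` A \<inter> B)"
    using finite_measure_Diff'[OF B tA] by (simp add: Int_commute)
  finally show ?thesis
    using iso_measure_image_Diff[OF t A B] iso_measure_image_Int[OF t A B] by simp
qed

text \<open>Conservation of mass: \<open>A\<close> and its preimage have equal measure and share the
  points that stay, so as much mass enters \<open>A\<close> as leaves it.\<close>

lemma iso_measure_leave:
  assumes t: "t \<in> borel_isos M" and A: "A \<in> sets M"
  shows "prob (t ` A - A) = prob {x \<in> A. t x \<notin> A}"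
    and "prob (t ` A - A) = prob {x \<in> space M. x \<notin> A \<and> t x \<in> A}"
proof -
  note [measurable] = iso_measurable[OF t] A
  have 1: "prob A = prob {x \<in> A. t x \<in> A} + prob {x \<in> A. t x \<notin> A}"
  proof -
    have "{x \<in> A. t x \<notin> A} = {x \<in> space M. x \<in> A \<and> t x \<notin> A}"
      using sets.sets_into_space[OF A] by auto
    then have "{x \<in> A. t x \<notin> A} \<in> sets M" by simp
    then have "prob ({x \<in> A. t x \<in> A} \<union> {x \<in> A. t x \<notin> A})
      = prob {x \<in> A. t x \<in> A} + prob {x \<in> A. t x \<notin> A}"
      using sets_Collect_iso[OF t A A] by (intro finite_measure_Union) auto
    moreover have "{x \<in> A. t x \<in> A} \<union> {x \<in> A. t x \<notin> A} = A" by auto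
    ultimately show ?thesis by simp
  qed
  have 2: "prob A = prob {x \<in> A. t x \<in> A} + prob {x \<in> space M. x \<notin> A \<and> t x \<in> A}"
  proof -
    have "prob ({x \<in> A. t x \<in> A} \<union> {x \<in> space M. x \<notin> A \<and> t x \<in> A})
      = prob {x \<in> A. t x \<in> A} + prob {x \<in> space M. x \<notin> A \<and> t x \<in> A}"
      using sets_Collect_iso[OF t A A] by (intro finite_measure_Union) auto
    moreover have "{x \<in> A. t x \<in> A} \<union> {x \<in> space M. x \<notin> A \<and> t x \<in> A} = {x \<in> space M. t x \<in> A}"
      using sets.sets_into_space[OF A] by auto
    ultimately show ?thesis using iso_measure_vimage[OF t A] by simp
  qed
  show "prob (t ` A - A) = prob {x \<in> A. t x \<notin> A}"
    and "prob (t ` A - A) = prob {x \<in> space M. x \<notin> A \<and> t x \<in> A}"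
    using iso_measure_image_Diff[OF t A A] 1 2 by simp_all
qed

end

section \<open>Weak topology and measurability in the automorphism\<close>

lemma openin_weak_subbasis:
  assumes "Y \<in> sets M" "Z \<in> sets M" "\<epsilon> > 0"
  shows "openin (weak_topology M) {a \<in> Aut M. measure M (sym_diff (rep a ` Y) Z) < \<epsilon>}"
  unfolding weak_topology_def using assms by (intro topology_generated_by_Basis) blast

lemma openin_weak_sets:
  assumes "openin (weak_topology M) U"
  shows "U \<in> sets (Aut_borel M)"
proof -
  have "{U. openin (weak_topology M) U} \<subseteq> Pow (Aut M)"
    using openin_subset topspace_weak_topology by blast
  then show ?thesis
    unfolding Aut_borel_def using assms by (intro in_measure_of) auto
qed

text \<open>Sublevel sets for positive \<open>\<epsilon>\<close> are subbasic open sets; the others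
  are empty.\<close>

lemma measurable_sym_diff_Aut:
  assumes "Y \<in> sets M" "Z \<in> sets M"
  shows "(\<lambda>a. measure M (sym_diff (rep a ` Y) Z)) \<in> borel_measurable (Aut_borel M)"
  unfolding borel_measurable_iff_less
proof
  fix \<epsilon> :: real
  show "{w \<in> space (Aut_borel M). measure M (sym_diff (rep w ` Y) Z) < \<epsilon>} \<in> sets (Aut_borel M)"
  proof (cases "\<epsilon> > 0")
    case True
    then show ?thesis
      using openin_weak_sets[OF openin_weak_subbasis[OF assms True]] by (simp add: space_Aut_borel)
  next
    case False
    have "\<not> measure M S < \<epsilon>" for S
      using measure_nonneg[of M S] False by linarith
    then show ?thesis by simp
  qed
qed

text \<open>A locale because it is instantiated for \<open>\<Lambda>\<close>, for its two
  components, and for the restricted law on an ergodic piece.\<close>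

locale aut_law = prob_space M + law: prob_space \<Lambda>
  for M :: "'a measure" and \<Lambda> :: "('a \<Rightarrow> 'a) set measure" +
  assumes sets_law: "sets \<Lambda> = sets (Aut_borel M)"
begin

lemma space_law: "space \<Lambda> = Aut M"
  using sets_law sets_eq_imp_space_eq space_Aut_borel by metis

lemma rep_iso: "a \<in> space \<Lambda> \<Longrightarrow> rep a \<in> borel_isos M"
  by (simp add: space_law rep_borel_isos)

lemma measurable_prob_rep:
  assumes A: "A \<in> sets M" and B: "B \<in> sets M"
  shows "(\<lambda>a. prob {x \<in> A. rep a x \<in> B}) \<in> borel_measurable \<Lambda>"
proof -
  have "(\<lambda>a. (prob A + prob B - prob (sym_diff (rep a ` A) B)) / 2) \<in> borel_measurable \<Lambda>"
    using measurable_sym_diff_Aut[OF A B] unfolding measurable_cong_sets[OF sets_law refl]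
    by (intro borel_measurable_divide borel_measurable_diff borel_measurable_const)
  moreover have "(prob A + prob B - prob (sym_diff (rep a ` A) B)) / 2 = prob {x \<in> A. rep a x \<in> B}"
    if "a \<in> space \<Lambda>" for a
    using iso_measure_sym_diff[OF rep_iso[OF that] A B] by simp
  ultimately show ?thesis by (simp cong: measurable_cong)
qed

lemma measurable_prob_leave:
  assumes A: "A \<in> sets M"
  shows "(\<lambda>a. prob (rep a ` A - A)) \<in> borel_measurable \<Lambda>"
proof -
  have "(\<lambda>a. prob A - prob {x \<in> A. rep a x \<in> A}) \<in> borel_measurable \<Lambda>"
    using measurable_prob_rep[OF A A] by measurable
  then show ?thesis
    using iso_measure_image_Diff[OF rep_iso A A] by (simp cong: measurable_cong)
qed

lemma integrable_prob_leave:
  assumes A: "A \<in> sets M"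
  shows "integrable \<Lambda> (\<lambda>a. prob (rep a ` A - A))"
  using measurable_prob_leave[OF A]
  by (intro law.integrable_const_bound[where B = 1]) (auto simp: measure_nonneg)

text \<open>Without joint measurability of \<open>(a, x) \<mapsto> rep a x\<close> this is no
  instance of Tonelli's theorem. Instead \<open>g\<close> and then \<open>f\<close> are built up
  from indicators, where the integral is \<open>prob {x \<in> B. rep a x \<in> A}\<close>.\<close>

lemma measurable_nn_integral_rep:
  fixes f g :: "'a \<Rightarrow> ennreal"
  assumes f: "f \<in> borel_measurable M" and g: "g \<in> borel_measurable M"
  shows "(\<lambda>a. \<integral>\<^sup>+x. f (rep a x) * g x \<partial>M) \<in> borel_measurable \<Lambda>"
  using g
proof (induction g rule: borel_measurable_induct)
  case (cong g h)
  then show ?case by (simp cong: nn_integral_cong)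
next
  case (set B)
  show ?case using f
  proof (induction f rule: borel_measurable_induct)
    case (cong f h)
    have "(\<integral>\<^sup>+x. f (rep a x) * indicator B x \<partial>M) = (\<integral>\<^sup>+x. h (rep a x) * indicator B x \<partial>M)"
      if "a \<in> space \<Lambda>" for a
      using cong.hyps measurable_space[OF iso_measurable[OF rep_iso[OF that]]]
      by (intro nn_integral_cong) auto
    then show ?case using cong by (simp cong: measurable_cong)
  next
    case (set A)
    have "(\<integral>\<^sup>+x. indicator A (rep a x) * indicator B x \<partial>M) = ennreal (prob {x \<in> B. rep a x \<in> A})"
      if "a \<in> space \<Lambda>" for a
    proof -
      have "(\<integral>\<^sup>+x. indicator A (rep a x) * indicator B x \<partial>M)
          = (\<integral>\<^sup>+x. indicator {x \<in> B. rep a x \<in> A} x \<partial>M)"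
        by (intro nn_integral_cong) (auto simp: indicator_def)
      then show ?thesis
        using sets_Collect_iso[OF rep_iso[OF that] \<open>B \<in> sets M\<close> \<open>A \<in> sets M\<close>] emeasure_eq_measure
        by simp
    qed
    then show ?case using measurable_prob_rep[OF \<open>B \<in> sets M\<close> \<open>A \<in> sets M\<close>]
      by (simp cong: measurable_cong)
  next
    case (mult u c)
    have "(\<integral>\<^sup>+x. c * u (rep a x) * indicator B x \<partial>M) = c * (\<integral>\<^sup>+x. u (rep a x) * indicator B x \<partial>M)"
      if "a \<in> space \<Lambda>" for a
      using iso_measurable[OF rep_iso[OF that]] mult(2) \<open>B \<in> sets M\<close>
      by (subst nn_integral_cmult[symmetric]) (auto simp: mult.assoc)
    then show ?case using mult by (simp cong: measurable_cong)
  next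
    case (add u v)
    have "(\<integral>\<^sup>+x. (v (rep a x) + u (rep a x)) * indicator B x \<partial>M)
        = (\<integral>\<^sup>+x. v (rep a x) * indicator B x \<partial>M) + (\<integral>\<^sup>+x. u (rep a x) * indicator B x \<partial>M)"
      if "a \<in> space \<Lambda>" for a
      using iso_measurable[OF rep_iso[OF that]] add \<open>B \<in> sets M\<close>
      by (subst nn_integral_add[symmetric]) (auto simp: distrib_right)
    then show ?case using add by (simp cong: measurable_cong)
  next
    case (seq U)
    have "(\<integral>\<^sup>+x. (SUP i. U i) (rep a x) * indicator B x \<partial>M)
        = (SUP i. \<integral>\<^sup>+x. U i (rep a x) * indicator B x \<partial>M)"
      if "a \<in> space \<Lambda>" for a
      using iso_measurable[OF rep_iso[OF that]] seq \<open>B \<in> sets M\<close>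
      by (subst nn_integral_monotone_convergence_SUP[symmetric])
        (auto simp: incseq_def le_fun_def mult_right_mono SUP_mult_right_ennreal image_comp)
    then show ?case using seq by (simp cong: measurable_cong)
  qed
next
  case (mult u c)
  have "(\<integral>\<^sup>+x. f (rep a x) * (c * u x) \<partial>M) = c * (\<integral>\<^sup>+x. f (rep a x) * u x \<partial>M)"
    if "a \<in> space \<Lambda>" for a
    using iso_measurable[OF rep_iso[OF that]] mult f
    by (subst nn_integral_cmult[symmetric]) (auto simp: ac_simps)
  then show ?case using mult by (simp cong: measurable_cong)
next
  case (add u v)
  have "(\<integral>\<^sup>+x. f (rep a x) * (v x + u x) \<partial>M)
      = (\<integral>\<^sup>+x. f (rep a x) * v x \<partial>M) + (\<integral>\<^sup>+x. f (rep a x) * u x \<partial>M)"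
    if "a \<in> space \<Lambda>" for a
    using iso_measurable[OF rep_iso[OF that]] add f
    by (subst nn_integral_add[symmetric]) (auto simp: distrib_left)
  then show ?case using add by (simp cong: measurable_cong)
next
  case (seq U)
  have "(\<integral>\<^sup>+x. f (rep a x) * (SUP i. U i) x \<partial>M) = (SUP i. \<integral>\<^sup>+x. f (rep a x) * U i x \<partial>M)"
    if "a \<in> space \<Lambda>" for a
    using iso_measurable[OF rep_iso[OF that]] seq f
    by (subst nn_integral_monotone_convergence_SUP[symmetric])
      (auto simp: incseq_def le_fun_def mult_left_mono SUP_mult_left_ennreal image_comp)
  then show ?case using seq by (simp cong: measurable_cong)
qed

end

subsection \<open>Square integrable functions\<close>

lemma
  assumes "f \<in> L2 M"
  shows L2_measurable: "f \<in> borel_measurable M"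
    and L2_integrable_square: "integrable M (\<lambda>x. (f x)\<^sup>2)"
  using assms by (auto simp: L2_def)

lemma L2_mult_integrable:
  assumes f: "f \<in> L2 M" and g: "g \<in> L2 M"
  shows "integrable M (\<lambda>x. f x * g x)"
proof (rule Bochner_Integration.integrable_bound)
  show "integrable M (\<lambda>x. (f x)\<^sup>2 + (g x)\<^sup>2)"
    using L2_integrable_square[OF f] L2_integrable_square[OF g] by simp
  show "(\<lambda>x. f x * g x) \<in> borel_measurable M"
    using L2_measurable[OF f] L2_measurable[OF g] by simp
  have "\<bar>u * v\<bar> \<le> u\<^sup>2 + v\<^sup>2" for u v :: real
    using sum_squares_bound[of "\<bar>u\<bar>" "\<bar>v\<bar>"] abs_ge_zero[of "u * v"]
    unfolding power2_abs abs_mult by linarith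
  then show "AE x in M. norm (f x * g x) \<le> norm ((f x)\<^sup>2 + (g x)\<^sup>2)" by simp
qed

lemma L2_diff:
  assumes f: "f \<in> L2 M" and g: "g \<in> L2 M"
  shows "(\<lambda>x. f x - g x) \<in> L2 M"
  using L2_measurable[OF f] L2_measurable[OF g] L2_integrable_square[OF f]
    L2_integrable_square[OF g] L2_mult_integrable[OF f g]
  by (simp add: L2_def power2_diff mult.assoc)

lemma L2_bound:
  assumes f: "f \<in> L2 M" and g: "g \<in> borel_measurable M" and "\<And>x. \<bar>g x\<bar> \<le> \<bar>f x\<bar>"
  shows "g \<in> L2 M"
proof -
  have "integrable M (\<lambda>x. (g x)\<^sup>2)"
    using assms
    by (intro Bochner_Integration.integrable_bound[OF L2_integrable_square[OF f]])
      (auto simp: abs_le_square_iff)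
  then show ?thesis using g by (simp add: L2_def)
qed

lemma L2_pos_part: "f \<in> L2 M \<Longrightarrow> (\<lambda>x. max 0 (f x)) \<in> L2 M"
  and L2_neg_part: "f \<in> L2 M \<Longrightarrow> (\<lambda>x. max 0 (- f x)) \<in> L2 M"
  by (auto intro!: L2_bound[of f] borel_measurable_max simp: L2_measurable)

lemma pos_part_minus_neg_part: "max 0 y - max 0 (- y) = (y :: real)"
  by auto

lemma L2_iso:
  assumes t: "t \<in> borel_isos M" and f: "f \<in> L2 M"
  shows "(\<lambda>x. f (t x)) \<in> L2 M"
proof -
  note [measurable] = iso_measurable[OF t] L2_measurable[OF f]
  have "integrable (distr M M t) (\<lambda>x. (f x)\<^sup>2)"
    using L2_integrable_square[OF f] by (simp add: iso_distr[OF t])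
  then show ?thesis by (simp add: L2_def integrable_distr_eq)
qed

lemma integral_iso:
  fixes f :: "'a \<Rightarrow> real"
  assumes t: "t \<in> borel_isos M" and [measurable]: "f \<in> borel_measurable M"
  shows "(\<integral>x. f (t x) \<partial>M) = (\<integral>x. f x \<partial>M)"
  using integral_distr[OF iso_measurable[OF t], of f] iso_distr[OF t] by simp

lemma inner_L2_iso_iso:
  assumes t: "t \<in> borel_isos M" and f: "f \<in> L2 M"
  shows "inner_L2 M (\<lambda>x. f (t x)) (\<lambda>x. f (t x)) = inner_L2 M f f"
  unfolding inner_L2_def
  using integral_iso[OF t, of "\<lambda>x. f x * f x"] L2_measurable[OF f] by simp

lemma inner_L2_commute: "inner_L2 M f g = inner_L2 M g f"
  by (simp add: inner_L2_def mult.commute)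

lemma inner_L2_diff_left:
  assumes "f \<in> L2 M" "f' \<in> L2 M" "g \<in> L2 M"
  shows "inner_L2 M (\<lambda>x. f x - f' x) g = inner_L2 M f g - inner_L2 M f' g"
  using assms by (simp add: inner_L2_def left_diff_distrib L2_mult_integrable)

lemma inner_L2_diff_right:
  assumes "f \<in> L2 M" "g \<in> L2 M" "g' \<in> L2 M"
  shows "inner_L2 M f (\<lambda>x. g x - g' x) = inner_L2 M f g - inner_L2 M f g'"
  using assms by (simp add: inner_L2_def right_diff_distrib L2_mult_integrable)

lemma inner_L2_self_nonneg: "0 \<le> inner_L2 M f f"
  by (simp add: inner_L2_def)

lemma inner_L2_diff_self:
  assumes f: "f \<in> L2 M" and g: "g \<in> L2 M"
  shows "(\<integral>x. (f x - g x)\<^sup>2 \<partial>M) = inner_L2 M f f + inner_L2 M g g - 2 * inner_L2 M f g"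
proof -
  have "(\<integral>x. (f x - g x)\<^sup>2 \<partial>M) = inner_L2 M (\<lambda>x. f x - g x) (\<lambda>x. f x - g x)"
    by (simp add: inner_L2_def power2_eq_square)
  then show ?thesis
    using f g by (simp add: inner_L2_diff_left inner_L2_diff_right L2_diff inner_L2_commute[of M g f])
qed

text \<open>Cauchy--Schwarz in additive form, read off from the squares of \<open>f - g\<close> and
  \<open>f + g\<close>. For functions of equal norm, such as \<open>f\<close> and its translates, it
  is as sharp as the product form.\<close>

lemma abs_inner_L2_le:
  assumes f: "f \<in> L2 M" and g: "g \<in> L2 M"
  shows "2 * \<bar>inner_L2 M f g\<bar> \<le> inner_L2 M f f + inner_L2 M g g"
proof -
  have m: "(\<lambda>x. - g x) \<in> L2 M" using g by (simp add: L2_def)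
  have "0 \<le> (\<integral>x. (f x - g x)\<^sup>2 \<partial>M)" "0 \<le> (\<integral>x. (f x - - g x)\<^sup>2 \<partial>M)" by simp_all
  then show ?thesis
    unfolding inner_L2_diff_self[OF f g] inner_L2_diff_self[OF f m] by (simp add: inner_L2_def)
qed

lemma ennreal_inner_L2:
  assumes f: "f \<in> L2 M" and g: "g \<in> L2 M" and "\<And>x. 0 \<le> f x" "\<And>x. 0 \<le> g x"
  shows "ennreal (inner_L2 M f g) = (\<integral>\<^sup>+x. ennreal (f x) * ennreal (g x) \<partial>M)"
  using assms nn_integral_eq_integral[OF L2_mult_integrable[OF f g]]
  by (simp add: inner_L2_def ennreal_mult)

subsection \<open>The averaging operator\<close>

context aut_law
begin

text \<open>The Radon--Nikodym theorem takes the place of the Riesz representation theorem in the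
  construction of the averaging operator.\<close>

lemma nn_avg_exists:
  fixes f :: "'a \<Rightarrow> ennreal"
  assumes f [measurable]: "f \<in> borel_measurable M"
  obtains h :: "'a \<Rightarrow> ennreal" where "h \<in> borel_measurable M"
    and "\<And>g. g \<in> borel_measurable M \<Longrightarrow>
      (\<integral>\<^sup>+x. h x * g x \<partial>M) = (\<integral>\<^sup>+a. (\<integral>\<^sup>+x. f (rep a x) * g x \<partial>M) \<partial>\<Lambda>)"
proof -
  define \<phi> where "\<phi> g = (\<integral>\<^sup>+a. (\<integral>\<^sup>+x. f (rep a x) * g x \<partial>M) \<partial>\<Lambda>)" for g :: "'a \<Rightarrow> ennreal"
  note [measurable] = measurable_nn_integral_rep[OF f]
  have rep_meas: "(\<lambda>x. f (rep a x)) \<in> borel_measurable M" if "a \<in> space \<Lambda>" for a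
    using measurable_compose[OF iso_measurable[OF rep_iso[OF that]] f] .
  \<comment> \<open>On indicators \<open>\<phi>\<close> is a measure; its density is the average of
    \<open>f\<close> over \<open>a\<close>.\<close>
  define \<nu> where "\<nu> = measure_of (space M) (sets M) (\<lambda>A. \<phi> (indicator A))"
  have sets_\<nu>: "sets \<nu> = sets M" by (simp add: \<nu>_def)
  have space_\<nu>: "space \<nu> = space M" by (simp add: \<nu>_def)
  have em: "emeasure \<nu> A = \<phi> (indicator A)" if "A \<in> sets M" for A
    unfolding \<nu>_def
  proof (rule emeasure_measure_of_sigma)
    show "sigma_algebra (space M) (sets M)" by (rule sets.sigma_algebra_axioms)
    show "positive (sets M) (\<lambda>A. \<phi> (indicator A))"
      by (simp add: positive_def \<phi>_def)
    show "countably_additive (sets M) (\<lambda>A. \<phi> (indicator A))"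
    proof (rule countably_additiveI)
      fix A :: "nat \<Rightarrow> 'a set"
      assume A: "range A \<subseteq> sets M" "disjoint_family A"
      then have A' [measurable]: "A i \<in> sets M" for i by auto
      have "(\<Sum>i. \<phi> (indicator (A i)))
          = (\<integral>\<^sup>+a. (\<Sum>i. \<integral>\<^sup>+x. f (rep a x) * indicator (A i) x \<partial>M) \<partial>\<Lambda>)"
        unfolding \<phi>_def by (subst nn_integral_suminf) auto
      also have "\<dots> = \<phi> (indicator (\<Union>i. A i))"
        unfolding \<phi>_def
        using rep_meas
        by (intro nn_integral_cong)
          (auto simp: nn_integral_suminf[symmetric] suminf_indicator[OF A(2)])
      finally show "(\<Sum>i. \<phi> (indicator (A i))) = \<phi> (indicator (\<Union>i. A i))" .
    qed
  qed (fact that)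
  \<comment> \<open>The null set \<open>A\<close> restricts the variable \<open>x\<close>, not its
    image, so the inner integral vanishes for every map \<open>t\<close> whatsoever.\<close>
  have "absolutely_continuous M \<nu>"
    unfolding absolutely_continuous_def
  proof
    fix A assume A: "A \<in> null_sets M"
    have "AE x in M. f (t x) * indicator A x = 0" for t
      using AE_not_in[OF A] by eventually_elim simp
    then have "(\<integral>\<^sup>+x. f (t x) * indicator A x \<partial>M) = 0" for t
      using nn_integral_cong_AE[of "\<lambda>x. f (t x) * indicator A x" "\<lambda>_. 0" M] by simp
    then have "\<phi> (indicator A) = 0" by (simp add: \<phi>_def)
    then have "emeasure \<nu> A = 0" using A em by auto
    then show "A \<in> null_sets \<nu>" using A sets_\<nu> by auto
  qed
  from Radon_Nikodym[OF this sets_\<nu>] obtain h where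
    h [measurable]: "h \<in> borel_measurable M" and dens: "density M h = \<nu>" by auto
  have "(\<integral>\<^sup>+x. g x \<partial>\<nu>) = \<phi> g" if "g \<in> borel_measurable M" for g
    using that
  proof (induction g rule: borel_measurable_induct)
    case (cong g g')
    have "(\<integral>\<^sup>+x. g x \<partial>\<nu>) = (\<integral>\<^sup>+x. g' x \<partial>\<nu>)"
      using cong.hyps(3) by (intro nn_integral_cong) (simp add: space_\<nu>)
    moreover have "\<phi> g = \<phi> g'"
      unfolding \<phi>_def using cong.hyps(3) by (intro nn_integral_cong) simp
    ultimately show ?case using cong by simp
  next
    case (set A)
    then show ?case by (simp add: em sets_\<nu>)
  next
    case (mult u c)
    then have "(\<integral>\<^sup>+a. (\<integral>\<^sup>+x. f (rep a x) * (c * u x) \<partial>M) \<partial>\<Lambda>)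
        = (\<integral>\<^sup>+a. c * (\<integral>\<^sup>+x. f (rep a x) * u x \<partial>M) \<partial>\<Lambda>)"
      using rep_meas
      by (intro nn_integral_cong) (auto simp: nn_integral_cmult[symmetric] ac_simps)
    then show ?case using mult
      by (simp add: \<phi>_def nn_integral_cmult measurable_cong_sets[OF sets_\<nu> refl])
  next
    case (add u v)
    then have "(\<integral>\<^sup>+a. (\<integral>\<^sup>+x. f (rep a x) * (v x + u x) \<partial>M) \<partial>\<Lambda>)
        = (\<integral>\<^sup>+a. (\<integral>\<^sup>+x. f (rep a x) * v x \<partial>M) + (\<integral>\<^sup>+x. f (rep a x) * u x \<partial>M) \<partial>\<Lambda>)"
      using rep_meas
      by (intro nn_integral_cong) (auto simp: nn_integral_add[symmetric] distrib_left)
    then show ?case using add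
      by (simp add: \<phi>_def nn_integral_add measurable_cong_sets[OF sets_\<nu> refl])
  next
    case (seq U)
    have [measurable]: "U i \<in> borel_measurable M" for i using seq by simp
    have [measurable]: "U i \<in> borel_measurable \<nu>" for i
      using seq by (simp add: measurable_cong_sets[OF sets_\<nu> refl])
    have "\<phi> (SUP i. U i) = (\<integral>\<^sup>+a. (SUP i. \<integral>\<^sup>+x. f (rep a x) * U i x \<partial>M) \<partial>\<Lambda>)"
      unfolding \<phi>_def using rep_meas \<open>incseq U\<close>
      by (intro nn_integral_cong, subst nn_integral_monotone_convergence_SUP[symmetric])
        (auto simp: incseq_def le_fun_def mult_left_mono SUP_mult_left_ennreal image_comp)
    also have "\<dots> = (SUP i. \<phi> (U i))"
      unfolding \<phi>_def using \<open>incseq U\<close>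
      by (intro nn_integral_monotone_convergence_SUP)
        (auto simp: incseq_def le_fun_def intro!: nn_integral_mono mult_left_mono)
    also have "\<dots> = (SUP i. \<integral>\<^sup>+x. U i x \<partial>\<nu>)" using seq by simp
    also have "\<dots> = (\<integral>\<^sup>+x. (SUP i. U i) x \<partial>\<nu>)"
      using \<open>incseq U\<close>
      by (subst nn_integral_monotone_convergence_SUP[symmetric]) (auto simp: SUP_apply[abs_def])
    finally show ?case by (rule sym)
  qed
  then have "(\<integral>\<^sup>+x. h x * g x \<partial>M) = \<phi> g" if "g \<in> borel_measurable M" for g
    using that by (simp add: nn_integral_density flip: dens)
  then show ?thesis using that h unfolding \<phi>_def by blast
qed

lemma L2_rep: "a \<in> space \<Lambda> \<Longrightarrow> f \<in> L2 M \<Longrightarrow> (\<lambda>x. f (rep a x)) \<in> L2 M"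
  by (rule L2_iso[OF rep_iso])

lemma measurable_inner_rep:
  assumes f: "f \<in> L2 M" and g: "g \<in> L2 M"
  shows "(\<lambda>a. inner_L2 M (\<lambda>x. f (rep a x)) g) \<in> borel_measurable \<Lambda>"
proof -
  have nonneg: "(\<lambda>a. inner_L2 M (\<lambda>x. f (rep a x)) g) \<in> borel_measurable \<Lambda>"
    if "f \<in> L2 M" "g \<in> L2 M" "\<And>x. 0 \<le> f x" "\<And>x. 0 \<le> g x" for f g
  proof -
    have "(\<lambda>a. enn2real (\<integral>\<^sup>+x. ennreal (f (rep a x)) * ennreal (g x) \<partial>M)) \<in> borel_measurable \<Lambda>"
      using measurable_nn_integral_rep[of "\<lambda>x. ennreal (f x)" "\<lambda>x. ennreal (g x)"]
        L2_measurable[OF that(1)] L2_measurable[OF that(2)] by measurable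
    moreover have "enn2real (\<integral>\<^sup>+x. ennreal (f (rep a x)) * ennreal (g x) \<partial>M)
        = inner_L2 M (\<lambda>x. f (rep a x)) g" if "a \<in> space \<Lambda>" for a
    proof -
      have "0 \<le> inner_L2 M (\<lambda>x. f (rep a x)) g"
        unfolding inner_L2_def
        using \<open>\<And>x. 0 \<le> f x\<close> \<open>\<And>x. 0 \<le> g x\<close> by (intro integral_nonneg_AE) auto
      then show ?thesis
        using ennreal_inner_L2[OF L2_rep[OF that \<open>f \<in> L2 M\<close>] \<open>g \<in> L2 M\<close>]
          \<open>\<And>x. 0 \<le> f x\<close> \<open>\<And>x. 0 \<le> g x\<close> by (metis enn2real_ennreal)
    qed
    ultimately show ?thesis by (simp cong: measurable_cong)
  qed
  let ?p = "\<lambda>(f::'a \<Rightarrow> real) x. max 0 (f x)" and ?n = "\<lambda>(f::'a \<Rightarrow> real) x. max 0 (- f x)"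
  let ?I = "\<lambda>f g a. inner_L2 M (\<lambda>x. f (rep a x)) g"
  note parts = L2_pos_part[OF f] L2_neg_part[OF f] L2_pos_part[OF g] L2_neg_part[OF g]
  have "(\<lambda>a. ?I (?p f) (?p g) a - ?I (?n f) (?p g) a - (?I (?p f) (?n g) a - ?I (?n f) (?n g) a))
      \<in> borel_measurable \<Lambda>"
    using parts by (intro borel_measurable_diff nonneg) auto
  moreover have "?I (?p f) (?p g) a - ?I (?n f) (?p g) a - (?I (?p f) (?n g) a - ?I (?n f) (?n g) a)
      = ?I f g a" if a: "a \<in> space \<Lambda>" for a
  proof -
    have "?I (?p f) g a - ?I (?n f) g a = ?I f g a" if "g \<in> L2 M" for g
      using inner_L2_diff_left[OF L2_rep[OF a parts(1)] L2_rep[OF a parts(2)] that]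
      by (simp add: pos_part_minus_neg_part)
    moreover have "?I f (?p g) a - ?I f (?n g) a = ?I f g a"
      using inner_L2_diff_right[OF L2_rep[OF a f] parts(3,4)]
      by (simp add: pos_part_minus_neg_part)
    ultimately show ?thesis using parts by simp
  qed
  ultimately show ?thesis by (simp cong: measurable_cong)
qed

lemma integrable_inner_rep:
  assumes f: "f \<in> L2 M" and g: "g \<in> L2 M"
  shows "integrable \<Lambda> (\<lambda>a. inner_L2 M (\<lambda>x. f (rep a x)) g)"
proof (rule law.integrable_const_bound)
  show "AE a in \<Lambda>. norm (inner_L2 M (\<lambda>x. f (rep a x)) g) \<le> inner_L2 M f f + inner_L2 M g g"
  proof (rule AE_I2)
    fix a assume a: "a \<in> space \<Lambda>"
    have "0 \<le> \<bar>inner_L2 M (\<lambda>x. f (rep a x)) g\<bar>" by simp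
    then show "norm (inner_L2 M (\<lambda>x. f (rep a x)) g) \<le> inner_L2 M f f + inner_L2 M g g"
      using abs_inner_L2_le[OF L2_rep[OF a f] g] inner_L2_iso_iso[OF rep_iso[OF a] f]
      unfolding real_norm_def by linarith
  qed
qed (rule measurable_inner_rep[OF f g])

text \<open>The density \<open>H\<close> is shown to be square integrable by testing it against its
  own truncations \<open>g\<close>: duality bounds the squared norm of \<open>g\<close> by the mean
  of the squared norms of \<open>f\<close> and \<open>g\<close>. As the norm of \<open>g\<close> is
  finite, it can be absorbed, which leaves a bound independent of the truncation.\<close>

lemma avg_exists_nonneg:
  assumes f: "f \<in> L2 M" and f0: "\<And>x. 0 \<le> f x"
  shows "\<exists>h\<in>L2 M. \<forall>g\<in>L2 M. inner_L2 M h g = (\<integral>a. inner_L2 M (\<lambda>x. f (rep a x)) g \<partial>\<Lambda>)"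
proof -
  note [measurable] = L2_measurable[OF f]
  obtain H where H [measurable]: "H \<in> borel_measurable M"
    and Hg: "\<And>g. g \<in> borel_measurable M \<Longrightarrow> (\<integral>\<^sup>+x. H x * g x \<partial>M)
        = (\<integral>\<^sup>+a. (\<integral>\<^sup>+x. ennreal (f (rep a x)) * g x \<partial>M) \<partial>\<Lambda>)"
    using nn_avg_exists[of "\<lambda>x. ennreal (f x)"] by auto
  have dual: "ennreal (\<integral>a. inner_L2 M (\<lambda>x. f (rep a x)) g \<partial>\<Lambda>) = (\<integral>\<^sup>+x. H x * ennreal (g x) \<partial>M)"
    if g: "g \<in> L2 M" and g0: "\<And>x. 0 \<le> g x" for g
  proof -
    have "0 \<le> inner_L2 M (\<lambda>x. f (rep a x)) g" for a
      unfolding inner_L2_def using f0 g0 by (intro integral_nonneg_AE) auto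
    then have "ennreal (\<integral>a. inner_L2 M (\<lambda>x. f (rep a x)) g \<partial>\<Lambda>)
        = (\<integral>\<^sup>+a. ennreal (inner_L2 M (\<lambda>x. f (rep a x)) g) \<partial>\<Lambda>)"
      using integrable_inner_rep[OF f g] by (simp add: nn_integral_eq_integral)
    also have "\<dots> = (\<integral>\<^sup>+a. (\<integral>\<^sup>+x. ennreal (f (rep a x)) * ennreal (g x) \<partial>M) \<partial>\<Lambda>)"
      by (intro nn_integral_cong ennreal_inner_L2 L2_rep f g f0 g0)
    finally show ?thesis using Hg L2_measurable[OF g] by simp
  qed
  have bound: "(\<integral>\<^sup>+x. (min (H x) (of_nat k))\<^sup>2 \<partial>M) \<le> ennreal (inner_L2 M f f)" for k
  proof -
    define g where "g x = enn2real (min (H x) (of_nat k))" for x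
    have eg: "ennreal (g x) = min (H x) (of_nat k)" for x
      unfolding g_def by (intro ennreal_enn2real) (simp add: min_less_iff_disj of_nat_less_top)
    have [measurable]: "g \<in> borel_measurable M" unfolding g_def by measurable
    have "\<bar>g x\<bar> \<le> real k" for x
    proof -
      have "ennreal (g x) \<le> ennreal (real k)" by (simp add: eg ennreal_of_nat_eq_real_of_nat)
      then show ?thesis using ennreal_le_iff[of "real k" "g x"] by (simp add: g_def)
    qed
    then have g: "g \<in> L2 M"
      by (intro L2_bound[where f = "\<lambda>_. real k" and g = g]) (auto simp: L2_def)
    have g0: "0 \<le> g x" for x by (simp add: g_def)
    have "ennreal (inner_L2 M g g) = (\<integral>\<^sup>+x. ennreal (g x) * ennreal (g x) \<partial>M)"
      by (rule ennreal_inner_L2[OF g g g0 g0])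
    also have "\<dots> \<le> (\<integral>\<^sup>+x. H x * ennreal (g x) \<partial>M)"
      by (intro nn_integral_mono mult_right_mono) (auto simp: eg)
    also have "\<dots> = ennreal (\<integral>a. inner_L2 M (\<lambda>x. f (rep a x)) g \<partial>\<Lambda>)"
      by (simp add: dual g g0)
    also have "(\<integral>a. inner_L2 M (\<lambda>x. f (rep a x)) g \<partial>\<Lambda>)
        \<le> (\<integral>a. (inner_L2 M f f + inner_L2 M g g) / 2 \<partial>\<Lambda>)"
    proof (intro integral_mono)
      fix a assume a: "a \<in> space \<Lambda>"
      show "inner_L2 M (\<lambda>x. f (rep a x)) g \<le> (inner_L2 M f f + inner_L2 M g g) / 2"
        using abs_inner_L2_le[OF L2_rep[OF a f] g] inner_L2_iso_iso[OF rep_iso[OF a] f] by simp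
    qed (auto intro: integrable_inner_rep f g)
    finally have "inner_L2 M g g \<le> (inner_L2 M f f + inner_L2 M g g) / 2"
      using inner_L2_self_nonneg[of M f] inner_L2_self_nonneg[of M g] by (simp add: law.prob_space ennreal_leI)
    then have "inner_L2 M g g \<le> inner_L2 M f f" by simp
    then have "ennreal (inner_L2 M g g) \<le> ennreal (inner_L2 M f f)" by (rule ennreal_leI)
    then show ?thesis
      using ennreal_inner_L2[OF g g g0 g0] by (simp add: eg power2_eq_square)
  qed
  have "(\<integral>\<^sup>+x. (H x)\<^sup>2 \<partial>M) = (\<integral>\<^sup>+x. (SUP k. (min (H x) (of_nat k))\<^sup>2) \<partial>M)"
  proof (intro nn_integral_cong)
    fix x
    have "(\<lambda>k. min (H x) (of_nat k)) \<longlonglongrightarrow> min (H x) top"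
      by (intro tendsto_min tendsto_const of_nat_tendsto_top_ennreal)
    then have "(\<lambda>k. (min (H x) (of_nat k)) * (min (H x) (of_nat k))) \<longlonglongrightarrow> H x * H x"
      by (intro tendsto_mult_ennreal) (auto simp: min_absorb1 intro: disjI1)
    moreover have "incseq (\<lambda>k. (min (H x) (of_nat k)) * (min (H x) (of_nat k)))"
      by (auto simp: incseq_def min_le_iff_disj intro!: mult_mono intro: of_nat_mono min.mono)
    ultimately show "(H x)\<^sup>2 = (SUP k. (min (H x) (of_nat k))\<^sup>2)"
      using LIMSEQ_SUP LIMSEQ_unique by (fastforce simp: power2_eq_square)
  qed
  also have "\<dots> = (SUP k. \<integral>\<^sup>+x. (min (H x) (of_nat k))\<^sup>2 \<partial>M)"
    by (intro nn_integral_monotone_convergence_SUP)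
      (auto simp: incseq_def le_fun_def intro!: power_mono min.mono of_nat_mono)
  also have "\<dots> \<le> ennreal (inner_L2 M f f)" by (intro SUP_least bound)
  finally have H2: "(\<integral>\<^sup>+x. (H x)\<^sup>2 \<partial>M) < \<infinity>"
    by (simp add: order_le_less_trans)
  then have "AE x in M. (H x)\<^sup>2 \<noteq> \<infinity>"
    by (intro nn_integral_PInf_AE) auto
  then have fin: "AE x in M. H x < \<infinity>"
    by eventually_elim (auto simp: power2_eq_square less_top[symmetric] ennreal_mult_eq_top_iff)
  \<comment> \<open>\<open>enn2real\<close> sends infinity to 0; by \<open>fin\<close> this alters
    \<open>H\<close> on a null set only.\<close>
  define h where "h x = enn2real (H x)" for x
  have [measurable]: "h \<in> borel_measurable M" unfolding h_def by measurable
  have eh: "AE x in M. ennreal (h x) = H x"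
    using fin by eventually_elim (simp add: h_def)
  have "(\<integral>\<^sup>+x. ennreal ((h x)\<^sup>2) \<partial>M) = (\<integral>\<^sup>+x. (H x)\<^sup>2 \<partial>M)"
    using eh by (intro nn_integral_cong_AE) (auto simp: h_def ennreal_power[symmetric] elim!: eventually_mono)
  then have hL2: "h \<in> L2 M"
    using H2 by (auto simp: L2_def intro!: integrableI_nonneg)
  have h0: "0 \<le> h x" for x by (simp add: h_def)
  have *: "inner_L2 M h g = (\<integral>a. inner_L2 M (\<lambda>x. f (rep a x)) g \<partial>\<Lambda>)"
    if g: "g \<in> L2 M" and g0: "\<And>x. 0 \<le> g x" for g
  proof -
    have "ennreal (inner_L2 M h g) = (\<integral>\<^sup>+x. H x * ennreal (g x) \<partial>M)"
      unfolding ennreal_inner_L2[OF hL2 g h0 g0]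
      using eh by (intro nn_integral_cong_AE) (auto elim!: eventually_mono)
    moreover have "0 \<le> (\<integral>a. inner_L2 M (\<lambda>x. f (rep a x)) g \<partial>\<Lambda>)"
      unfolding inner_L2_def using f0 g0
      by (intro Bochner_Integration.integral_nonneg mult_nonneg_nonneg)
    moreover have "0 \<le> inner_L2 M h g"
      unfolding inner_L2_def using h0 g0 by (intro integral_nonneg_AE) auto
    ultimately show ?thesis
      using dual[OF g g0] by (metis ennreal_inj)
  qed
  have "inner_L2 M h g = (\<integral>a. inner_L2 M (\<lambda>x. f (rep a x)) g \<partial>\<Lambda>)" if g: "g \<in> L2 M" for g
  proof -
    let ?p = "\<lambda>x. max 0 (g x)" and ?n = "\<lambda>x. max 0 (- g x)"
    note parts = L2_pos_part[OF g] L2_neg_part[OF g]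
    have "inner_L2 M h g = inner_L2 M h ?p - inner_L2 M h ?n"
      using inner_L2_diff_right[OF hL2 parts] by (simp add: pos_part_minus_neg_part)
    also have "\<dots> = (\<integral>a. inner_L2 M (\<lambda>x. f (rep a x)) ?p - inner_L2 M (\<lambda>x. f (rep a x)) ?n \<partial>\<Lambda>)"
      using parts by (simp add: * integrable_inner_rep f)
    also have "\<dots> = (\<integral>a. inner_L2 M (\<lambda>x. f (rep a x)) g \<partial>\<Lambda>)"
      using inner_L2_diff_right[OF L2_rep[OF _ f] parts]
      by (intro Bochner_Integration.integral_cong) (auto simp: pos_part_minus_neg_part)
    finally show ?thesis .
  qed
  then show ?thesis using hL2 by blast
qed

lemma avg_exists:
  assumes f: "f \<in> L2 M"
  shows "\<exists>h\<in>L2 M. \<forall>g\<in>L2 M. inner_L2 M h g = (\<integral>a. inner_L2 M (\<lambda>x. f (rep a x)) g \<partial>\<Lambda>)"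
proof -
  let ?p = "\<lambda>x. max 0 (f x)" and ?n = "\<lambda>x. max 0 (- f x)"
  note parts = L2_pos_part[OF f] L2_neg_part[OF f]
  obtain h1 where h1: "h1 \<in> L2 M" "\<And>g. g \<in> L2 M \<Longrightarrow>
      inner_L2 M h1 g = (\<integral>a. inner_L2 M (\<lambda>x. ?p (rep a x)) g \<partial>\<Lambda>)"
    using avg_exists_nonneg[OF parts(1)] max.cobounded1 by metis
  obtain h2 where h2: "h2 \<in> L2 M" "\<And>g. g \<in> L2 M \<Longrightarrow>
      inner_L2 M h2 g = (\<integral>a. inner_L2 M (\<lambda>x. ?n (rep a x)) g \<partial>\<Lambda>)"
    using avg_exists_nonneg[OF parts(2)] max.cobounded1 by metis
  have "inner_L2 M (\<lambda>x. h1 x - h2 x) g = (\<integral>a. inner_L2 M (\<lambda>x. f (rep a x)) g \<partial>\<Lambda>)"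
    if g: "g \<in> L2 M" for g
  proof -
    have "inner_L2 M (\<lambda>x. h1 x - h2 x) g
        = (\<integral>a. inner_L2 M (\<lambda>x. ?p (rep a x)) g - inner_L2 M (\<lambda>x. ?n (rep a x)) g \<partial>\<Lambda>)"
      unfolding inner_L2_diff_left[OF h1(1) h2(1) g] h1(2)[OF g] h2(2)[OF g]
      by (rule Bochner_Integration.integral_diff[symmetric]; rule integrable_inner_rep)
        (use parts g in auto)
    also have "\<dots> = (\<integral>a. inner_L2 M (\<lambda>x. f (rep a x)) g \<partial>\<Lambda>)"
    proof (intro Bochner_Integration.integral_cong refl)
      fix a assume a: "a \<in> space \<Lambda>"
      show "inner_L2 M (\<lambda>x. ?p (rep a x)) g - inner_L2 M (\<lambda>x. ?n (rep a x)) g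
          = inner_L2 M (\<lambda>x. f (rep a x)) g"
        using inner_L2_diff_left[OF L2_rep[OF a parts(1)] L2_rep[OF a parts(2)] g]
        by (simp add: pos_part_minus_neg_part)
    qed
    finally show ?thesis .
  qed
  then show ?thesis using L2_diff[OF h1(1) h2(1)] by blast
qed

text \<open>The quadratic form of the averaging operator, written as an average over
  \<open>a\<close>: it does not mention the function chosen by \<open>avg_op\<close>, and it is all
  that the spectral estimates use.\<close>

definition corr :: "('a \<Rightarrow> real) \<Rightarrow> real" where
  "corr f = (\<integral>a. inner_L2 M (\<lambda>x. f (rep a x)) f \<partial>\<Lambda>)"

text \<open>Here the existence of the averaged function is put to use: \<open>avg_op\<close> is a
  choice, and only a witness gives it its defining property.\<close>

lemma inner_avg_op:
  assumes f: "f \<in> L2 M"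
  shows "inner_L2 M (avg_op M \<Lambda> f) f = corr f"
proof -
  let ?P = "\<lambda>h. h \<in> L2 M \<and> (\<forall>g\<in>L2 M. inner_L2 M h g = (\<integral>a. inner_L2 M (\<lambda>x. f (rep a x)) g \<partial>\<Lambda>))"
  have "?P (avg_op M \<Lambda> f)"
    unfolding avg_op_def using avg_exists[OF f] by (intro someI_ex[of ?P]) blast
  then show ?thesis using f by (simp add: corr_def)
qed

lemma corr_le_inner:
  assumes f: "f \<in> L2 M"
  shows "corr f \<le> inner_L2 M f f"
proof -
  have "corr f \<le> (\<integral>a. inner_L2 M f f \<partial>\<Lambda>)"
    unfolding corr_def
  proof (intro integral_mono integrable_inner_rep f)
    fix a assume a: "a \<in> space \<Lambda>"
    show "inner_L2 M (\<lambda>x. f (rep a x)) f \<le> inner_L2 M f f"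
      using abs_inner_L2_le[OF L2_rep[OF a f] f] inner_L2_iso_iso[OF rep_iso[OF a] f] by simp
  qed simp
  then show ?thesis by (simp add: law.prob_space)
qed

lemma inner_L2_self_pos:
  assumes f: "f \<in> L2 M" and "\<not> (AE x in M. f x = 0)"
  shows "0 < inner_L2 M f f"
proof -
  have "inner_L2 M f f \<noteq> 0"
    using assms(2) integral_nonneg_eq_0_iff_AE[OF L2_mult_integrable[OF f f]]
    by (auto simp: inner_L2_def)
  then show ?thesis using inner_L2_self_nonneg[of M f] by linarith
qed

text \<open>A function that vanishes almost everywhere has no quotient and is treated apart. For the
  others, the quotients must be bounded above before the real \<open>Sup\<close> says anything;
  \<open>corr_le_inner\<close> bounds them by 1.\<close>

lemma corr_le_rho_plus:
  assumes "f \<in> L2_zero M"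
  shows "corr f \<le> rho_plus M \<Lambda> * inner_L2 M f f"
proof (cases "AE x in M. f x = 0")
  case True
  have "inner_L2 M g f = 0" for g
    unfolding inner_L2_def using True
    by (intro integral_eq_zero_AE) (auto elim: eventually_mono)
  then show ?thesis by (simp add: corr_def)
next
  case False
  have f: "f \<in> L2 M" using assms by (simp add: L2_zero_def)
  have in_set: "corr f / inner_L2 M f f \<in> rayleigh_quotients M \<Lambda>"
    unfolding rayleigh_quotients_def
    by (intro CollectI exI[of _ f] conjI) (simp_all add: assms False inner_avg_op[OF f])
  have "bdd_above (rayleigh_quotients M \<Lambda>)"
  proof (rule bdd_aboveI)
    fix r assume "r \<in> rayleigh_quotients M \<Lambda>"
    then obtain g where g: "g \<in> L2 M" "\<not> (AE x in M. g x = 0)"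
      and r: "r = inner_L2 M (avg_op M \<Lambda> g) g / inner_L2 M g g"
      unfolding rayleigh_quotients_def L2_zero_def by blast
    show "r \<le> 1"
      using corr_le_inner[OF g(1)] inner_L2_self_pos[OF g] by (simp add: r inner_avg_op[OF g(1)])
  qed
  then have "corr f / inner_L2 M f f \<le> rho_plus M \<Lambda>"
    using in_set by (auto simp: rho_plus_def intro: cSup_upper)
  then show ?thesis using inner_L2_self_pos[OF f False] by (simp add: divide_le_eq)
qed

text \<open>The assumption \<open>-1 \<le> r\<close> covers a space without quotients, where
  \<open>rho_plus\<close> is -1 by convention.\<close>

lemma rho_plus_le:
  assumes "-1 \<le> r" and "\<And>f. f \<in> L2_zero M \<Longrightarrow> corr f \<le> r * inner_L2 M f f"
  shows "rho_plus M \<Lambda> \<le> r"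
proof (cases "rayleigh_quotients M \<Lambda> = {}")
  case False
  have "q \<le> r" if q_in: "q \<in> rayleigh_quotients M \<Lambda>" for q
  proof -
    obtain f where f: "f \<in> L2_zero M" "\<not> (AE x in M. f x = 0)"
      and q: "q = inner_L2 M (avg_op M \<Lambda> f) f / inner_L2 M f f"
      using q_in unfolding rayleigh_quotients_def by blast
    have "f \<in> L2 M" using f(1) by (simp add: L2_zero_def)
    then show ?thesis
      using assms(2)[OF f(1)] inner_L2_self_pos[OF _ f(2)]
      by (simp add: q inner_avg_op divide_le_eq)
  qed
  then have "Sup (rayleigh_quotients M \<Lambda>) \<le> r" using False by (intro cSup_least)
  then show ?thesis using False by (simp add: rho_plus_def)
qed (simp add: rho_plus_def assms(1))

end

subsection \<open>Expansion\<close>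

context aut_law
begin

lemma expansion_nonneg: "0 \<le> expansion M \<Lambda> A"
  unfolding expansion_def by (rule Bochner_Integration.integral_nonneg) simp

text \<open>This crude bound is all that is asked of the component
  \<open>\<Lambda>\<^sub>2\<close>.\<close>

lemma expansion_le:
  assumes A: "A \<in> sets M"
  shows "expansion M \<Lambda> A \<le> prob A"
proof -
  have "expansion M \<Lambda> A \<le> (\<integral>a. prob A \<partial>\<Lambda>)"
    unfolding expansion_def
  proof (intro integral_mono integrable_prob_leave A)
    fix a assume "a \<in> space \<Lambda>"
    then show "prob (rep a ` A - A) \<le> prob A"
      using iso_measure_image_Diff[OF rep_iso A A] by simp
  qed simp
  then show ?thesis by (simp add: law.prob_space)
qed

text \<open>A common frame for intersections, with \<open>r = 0\<close>, and for perturbations, with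
  \<open>C = {}\<close>: the estimate is made for a single automorphism and then integrated.\<close>

lemma expansion_mono_sum:
  assumes "A \<in> sets M" "B \<in> sets M" "C \<in> sets M"
    and "\<And>a. a \<in> space \<Lambda> \<Longrightarrow>
      prob (rep a ` A - A) \<le> prob (rep a ` B - B) + prob (rep a ` C - C) + r"
  shows "expansion M \<Lambda> A \<le> expansion M \<Lambda> B + expansion M \<Lambda> C + r"
proof -
  have "expansion M \<Lambda> A \<le> (\<integral>a. prob (rep a ` B - B) + prob (rep a ` C - C) + r \<partial>\<Lambda>)"
    unfolding expansion_def using assms
    by (intro integral_mono integrable_prob_leave Bochner_Integration.integrable_add) auto
  also have "\<dots> = expansion M \<Lambda> B + expansion M \<Lambda> C + r"
    using assms by (simp add: expansion_def integrable_prob_leave law.prob_space)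
  finally show ?thesis .
qed

text \<open>What leaves the complement is what enters \<open>A\<close>, and conservation of mass
  equates this with what leaves \<open>A\<close>.\<close>

lemma expansion_compl:
  assumes A: "A \<in> sets M"
  shows "expansion M \<Lambda> (space M - A) = expansion M \<Lambda> A"
  unfolding expansion_def
proof (intro Bochner_Integration.integral_cong refl)
  fix a assume a: "a \<in> space \<Lambda>"
  have "{x \<in> space M - A. rep a x \<notin> space M - A} = {x \<in> space M. x \<notin> A \<and> rep a x \<in> A}"
    using measurable_space[OF iso_measurable[OF rep_iso[OF a]]] by auto
  then show "prob (rep a ` (space M - A) - (space M - A)) = prob (rep a ` A - A)"
    using iso_measure_leave[OF rep_iso[OF a] A] iso_measure_leave(1)[OF rep_iso[OF a], of "space M - A"] A
    by auto
qed

lemma sets_leave: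
  assumes a: "a \<in> space \<Lambda>" and A: "A \<in> sets M" and B: "B \<in> sets M"
  shows "{x \<in> A. rep a x \<notin> B} \<in> sets M"
proof -
  have "{x \<in> A. rep a x \<notin> B} = A - {x \<in> A. rep a x \<in> B}" by auto
  then show ?thesis using sets_Collect_iso[OF rep_iso[OF a] A B] A by auto
qed

text \<open>A point that leaves \<open>A \<inter> B\<close> leaves \<open>A\<close> or
  \<open>B\<close>. Almost invariant sets can thus be intersected, at the price of doubling the
  error.\<close>

lemma expansion_Int_le:
  assumes A: "A \<in> sets M" and B: "B \<in> sets M"
  shows "expansion M \<Lambda> (A \<inter> B) \<le> expansion M \<Lambda> A + expansion M \<Lambda> B"
proof -
  have "prob (rep a ` (A \<inter> B) - A \<inter> B) \<le> prob (rep a ` A - A) + prob (rep a ` B - B) + 0"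
    if a: "a \<in> space \<Lambda>" for a
  proof -
    have "prob {x \<in> A \<inter> B. rep a x \<notin> A \<inter> B} \<le> prob ({x \<in> A. rep a x \<notin> A} \<union> {x \<in> B. rep a x \<notin> B})"
      using sets_leave[OF a] A B by (intro finite_measure_mono) auto
    also have "\<dots> \<le> prob {x \<in> A. rep a x \<notin> A} + prob {x \<in> B. rep a x \<notin> B}"
      using sets_leave[OF a] A B by (intro measure_Un_le) auto
    finally show ?thesis
      using iso_measure_leave(1)[OF rep_iso[OF a]] A B by auto
  qed
  then have "expansion M \<Lambda> (A \<inter> B) \<le> expansion M \<Lambda> A + expansion M \<Lambda> B + 0"
    using A B by (intro expansion_mono_sum) auto
  then show ?thesis by simp
qed

text \<open>A point that leaves \<open>A\<close> leaves \<open>B\<close>, or starts in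
  \<open>A - B\<close>, or lands in \<open>B - A\<close>. So the expansion is continuous on the
  measure algebra, and a limit of almost invariant sets is invariant.\<close>

lemma expansion_le_sym_diff:
  assumes A: "A \<in> sets M" and B: "B \<in> sets M"
  shows "expansion M \<Lambda> A \<le> expansion M \<Lambda> B + prob (sym_diff A B)"
proof -
  have "prob (rep a ` A - A) \<le> prob (rep a ` B - B) + prob (rep a ` {} - {}) + prob (sym_diff A B)"
    if a: "a \<in> space \<Lambda>" for a
  proof -
    have [measurable]: "rep a \<in> M \<rightarrow>\<^sub>M M" using iso_measurable[OF rep_iso[OF a]] .
    have S: "{x \<in> space M. rep a x \<in> B - A} \<in> sets M" using A B by measurable
    have "prob {x \<in> A. rep a x \<notin> A}
        \<le> prob ({x \<in> B. rep a x \<notin> B} \<union> ((A - B) \<union> {x \<in> space M. rep a x \<in> B - A}))"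
      using sets_leave[OF a] A B S sets.sets_into_space[OF A]
      by (intro finite_measure_mono) auto
    also have "\<dots> \<le> prob {x \<in> B. rep a x \<notin> B} + (prob (A - B) + prob {x \<in> space M. rep a x \<in> B - A})"
      using sets_leave[OF a] A B S
      by (intro order_trans[OF measure_Un_le] add_left_mono order_trans[OF measure_Un_le]) auto
    also have "prob {x \<in> space M. rep a x \<in> B - A} = prob (B - A)"
      using A B by (intro iso_measure_vimage[OF rep_iso[OF a]]) auto
    also have "prob (A - B) + prob (B - A) = prob (sym_diff A B)"
      using A B by (intro finite_measure_Union[symmetric]) auto
    finally show ?thesis
      using iso_measure_leave(1)[OF rep_iso[OF a]] A B by simp
  qed
  then have "expansion M \<Lambda> A \<le> expansion M \<Lambda> B + expansion M \<Lambda> {} + prob (sym_diff A B)"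
    using A B by (intro expansion_mono_sum) auto
  then show ?thesis by (simp add: expansion_def)
qed

lemma expansion_ge:
  assumes A [measurable]: "A \<in> sets M"
  shows "(1 - rho_plus M \<Lambda>) * (prob A * (1 - prob A)) \<le> expansion M \<Lambda> A"
proof -
  define m where "m = prob A"
  define f where "f x = indicator A x - m" for x
  have L2: "f \<in> L2 M"
    unfolding f_def
    by (rule L2_diff) (auto simp: L2_def indicator_def power2_eq_square
        intro!: integrable_const_bound[where B = 1])
  have ind: "integrable M (indicat_real S)" "expectation (indicat_real S) = prob S" if "S \<in> sets M" for S
    using that by (auto intro!: integrable_const_bound[where B = 1])
  note [simp] = ind[OF A]
  have "f \<in> L2_zero M"
    using L2 by (simp add: L2_zero_def f_def[abs_def] m_def prob_space)
  \<comment> \<open>The two mixed terms of the product contribute \<open>- m\<^sup>2\<close> each,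
    because \<open>t\<close> preserves the measure of \<open>A\<close>; the constant term gives one
    \<open>m\<^sup>2\<close> back.\<close>
  have inner: "inner_L2 M (\<lambda>x. f (t x)) f = prob A - prob (t ` A - A) - m\<^sup>2"
    if t: "t \<in> borel_isos M" for t
  proof -
    note [measurable] = iso_measurable[OF t]
    have tA: "{x \<in> A. t x \<in> A} \<in> sets M" by (rule sets_Collect_iso[OF t A A])
    have vA: "{x \<in> space M. t x \<in> A} \<in> sets M" by measurable
    have "inner_L2 M (\<lambda>x. f (t x)) f = (\<integral>x. indicator {x \<in> A. t x \<in> A} x
        - m * indicator {x \<in> space M. t x \<in> A} x - m * indicator A x + m\<^sup>2 \<partial>M)"
      unfolding inner_L2_def f_def
      by (intro Bochner_Integration.integral_cong)
        (auto simp: indicator_def algebra_simps power2_eq_square)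
    also have "\<dots> = prob {x \<in> A. t x \<in> A} - m * prob {x \<in> space M. t x \<in> A} - m * m + m\<^sup>2"
      using ind[OF tA] ind[OF vA] by (simp add: m_def prob_space)
    finally show ?thesis
      using iso_measure_vimage[OF t A] iso_measure_image_Diff[OF t A A]
      by (simp add: m_def power2_eq_square)
  qed
  have "corr f = (\<integral>a. m - prob (rep a ` A - A) - m\<^sup>2 \<partial>\<Lambda>)"
    unfolding corr_def m_def
    by (intro Bochner_Integration.integral_cong refl) (simp add: inner rep_iso m_def)
  also have "\<dots> = m - expansion M \<Lambda> A - m\<^sup>2"
    by (simp add: expansion_def integrable_prob_leave law.prob_space)
  finally have "corr f = m - expansion M \<Lambda> A - m\<^sup>2" .
  moreover have "inner_L2 M f f = m - m\<^sup>2"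
  proof -
    have "inner_L2 M f f = (\<integral>x. (1 - 2 * m) * indicator A x + m\<^sup>2 \<partial>M)"
      unfolding inner_L2_def f_def
      by (intro Bochner_Integration.integral_cong)
        (auto simp: indicator_def algebra_simps power2_eq_square)
    also have "\<dots> = (1 - 2 * m) * m + m\<^sup>2" by (simp add: m_def prob_space)
    finally show ?thesis by (simp add: algebra_simps power2_eq_square)
  qed
  ultimately have "m - expansion M \<Lambda> A - m\<^sup>2 \<le> rho_plus M \<Lambda> * (m - m\<^sup>2)"
    using corr_le_rho_plus[OF \<open>f \<in> L2_zero M\<close>] by simp
  then show ?thesis
    by (simp add: m_def algebra_simps power2_eq_square)
qed

section \<open>Invariant sets and the ergodic decomposition\<close>

lemma invariant_compl: "invariant_set M \<Lambda> A \<Longrightarrow> invariant_set M \<Lambda> (space M - A)"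
  by (auto simp: invariant_set_def expansion_compl)

lemma invariant_Int: "invariant_set M \<Lambda> A \<Longrightarrow> invariant_set M \<Lambda> B \<Longrightarrow> invariant_set M \<Lambda> (A \<inter> B)"
  using expansion_Int_le[of A B] expansion_nonneg[of "A \<inter> B"]
  by (auto simp: invariant_set_def)

lemma invariant_Diff:
  assumes "invariant_set M \<Lambda> A" "invariant_set M \<Lambda> B"
  shows "invariant_set M \<Lambda> (A - B)"
proof -
  have "A - B = A \<inter> (space M - B)"
    using assms(1) sets.sets_into_space by (auto simp: invariant_set_def)
  then show ?thesis using assms by (simp add: invariant_Int invariant_compl)
qed

lemma invariant_space: "invariant_set M \<Lambda> (space M)"
  using invariant_compl[of "{}"] by (simp add: invariant_set_def expansion_def)

text \<open>A set that is not ergodic splits into two invariant parts of measure at least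
  \<open>c\<close>, so each part has lost at least \<open>c\<close>. Hence induction on a number
  \<open>n\<close> with \<open>prob Y < n * c\<close>.\<close>

lemma ergodic_decomposition:
  assumes c: "0 < c" "\<And>Y. invariant_set M \<Lambda> Y \<Longrightarrow> 0 < prob Y \<Longrightarrow> c \<le> prob Y"
    and "invariant_set M \<Lambda> Y" "0 < prob Y"
  shows "\<exists>\<X>. finite \<X> \<and> disjoint \<X> \<and> \<Union>\<X> = Y \<and> (\<forall>Z\<in>\<X>. ergodic_set M \<Lambda> Z \<and> 0 < prob Z)"
proof -
  obtain n :: nat where "prob Y < n * c"
    using reals_Archimedean3[OF c(1)] by blast
  then show ?thesis using assms(3,4)
  proof (induction n arbitrary: Y)
    case 0
    then show ?case by simp
  next
    case (Suc n)
    show ?case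
    proof (cases "ergodic_set M \<Lambda> Y")
      case True
      then show ?thesis using Suc.prems by (intro exI[of _ "{Y}"]) simp
    next
      case False
      then obtain Z where Z: "invariant_set M \<Lambda> Z" "Z \<subseteq> Y" "prob Z \<noteq> 0" "prob (Y - Z) \<noteq> 0"
        using Suc.prems unfolding ergodic_set_def by blast
      have YZ: "invariant_set M \<Lambda> (Y - Z)" using Suc.prems Z by (simp add: invariant_Diff)
      have pos: "0 < prob Z" "0 < prob (Y - Z)"
        using Z by (simp_all add: zero_less_measure_iff)
      have "prob Y = prob Z + prob (Y - Z)"
        using Z Suc.prems by (simp add: finite_measure_Diff invariant_set_def)
      then have small: "prob Z < n * c" "prob (Y - Z) < n * c"
        using Suc.prems(1) c(2)[OF Z(1) pos(1)] c(2)[OF YZ pos(2)] by (simp_all add: algebra_simps)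
      obtain \<X> where X: "finite \<X>" "disjoint \<X>" "\<Union>\<X> = Z" "\<forall>Z\<in>\<X>. ergodic_set M \<Lambda> Z \<and> 0 < prob Z"
        using Suc.IH[OF small(1) Z(1) pos(1)] by blast
      obtain \<Y> where Y: "finite \<Y>" "disjoint \<Y>" "\<Union>\<Y> = Y - Z" "\<forall>Z\<in>\<Y>. ergodic_set M \<Lambda> Z \<and> 0 < prob Z"
        using Suc.IH[OF small(2) YZ pos(2)] by blast
      have "disjoint (\<X> \<union> \<Y>)"
        using X(2,3) Y(2,3) by (intro disjoint_union) auto
      then show ?thesis using X Y Z(2) by (intro exI[of _ "\<X> \<union> \<Y>"]) auto
    qed
  qed
qed

end

section \<open>Convex combinations of laws\<close>

lemma nn_integral_mixture:
  fixes c1 c2 :: ennreal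
  assumes "sets N1 = sets N" "sets N2 = sets N"
    and em: "\<And>A. A \<in> sets N \<Longrightarrow> emeasure N A = c1 * emeasure N1 A + c2 * emeasure N2 A"
    and "f \<in> borel_measurable N"
  shows "(\<integral>\<^sup>+x. f x \<partial>N) = c1 * (\<integral>\<^sup>+x. f x \<partial>N1) + c2 * (\<integral>\<^sup>+x. f x \<partial>N2)"
  using assms(4)
proof (induction f rule: borel_measurable_induct)
  note sp = assms(1,2)[THEN sets_eq_imp_space_eq]
  note [measurable_cong] = assms(1,2)
  {
    case (cong f g)
    have "(\<integral>\<^sup>+x. f x \<partial>N) = (\<integral>\<^sup>+x. g x \<partial>N)" "(\<integral>\<^sup>+x. f x \<partial>N1) = (\<integral>\<^sup>+x. g x \<partial>N1)"
      "(\<integral>\<^sup>+x. f x \<partial>N2) = (\<integral>\<^sup>+x. g x \<partial>N2)"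
      using cong.hyps(3) by (auto intro!: nn_integral_cong simp: sp)
    then show ?case using cong by simp
  next
    case (set A)
    then show ?case using assms(1,2) by (simp add: em)
  next
    case (mult u c)
    have [measurable]: "u \<in> borel_measurable N" by fact
    show ?case using mult by (simp add: nn_integral_cmult distrib_left ac_simps)
  next
    case (add u v)
    have [measurable]: "u \<in> borel_measurable N" "v \<in> borel_measurable N" by fact+
    show ?case using add by (simp add: nn_integral_add distrib_left ac_simps)
  next
    case (seq U)
    have [measurable]: "U i \<in> borel_measurable N" for i using seq by simp
    have S: "(\<integral>\<^sup>+x. (SUP i. U i) x \<partial>L) = (SUP i. \<integral>\<^sup>+x. U i x \<partial>L)"
      if "sets L = sets N" for L
      using \<open>incseq U\<close> that seq(1) unfolding SUP_apply[abs_def] image_comp comp_def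
      by (intro nn_integral_monotone_convergence_SUP) (auto cong: measurable_cong_sets)
    have inc: "incseq (\<lambda>i. c * (\<integral>\<^sup>+x. U i x \<partial>L))" for c :: ennreal and L :: "'a measure"
      using \<open>incseq U\<close>
      by (auto simp: incseq_def le_fun_def intro!: mult_left_mono nn_integral_mono)
    show ?case
      unfolding S[OF refl] S[OF assms(1)] S[OF assms(2)]
      using seq.IH by (simp add: SUP_mult_left_ennreal ennreal_SUP_add[OF inc inc])
  }
qed

text \<open>The mixture is given for measures of sets. The integrand is nonnegative, so the identity
  extends to its integral in \<open>ennreal\<close> and is then read back in the reals.\<close>

lemma expansion_mixture:
  fixes M :: "'a measure"
  assumes "aut_law M \<Lambda>" "aut_law M \<Lambda>\<^sub>1" "aut_law M \<Lambda>\<^sub>2" and \<kappa>: "0 \<le> \<kappa>" "\<kappa> \<le> 1"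
    and mix: "\<And>A. A \<in> sets (Aut_borel M) \<Longrightarrow>
      measure \<Lambda> A = \<kappa> * measure \<Lambda>\<^sub>1 A + (1 - \<kappa>) * measure \<Lambda>\<^sub>2 A"
    and A: "A \<in> sets M"
  shows "expansion M \<Lambda> A = \<kappa> * expansion M \<Lambda>\<^sub>1 A + (1 - \<kappa>) * expansion M \<Lambda>\<^sub>2 A"
proof -
  interpret L: aut_law M \<Lambda> by fact
  interpret L1: aut_law M \<Lambda>\<^sub>1 by fact
  interpret L2: aut_law M \<Lambda>\<^sub>2 by fact
  have nn: "(\<integral>\<^sup>+a. ennreal (measure M (rep a ` A - A)) \<partial>L) = ennreal (expansion M L A)"
    if "aut_law M L" for L
    using aut_law.integrable_prob_leave[OF that A]
    by (simp add: expansion_def nn_integral_eq_integral)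
  have "(\<integral>\<^sup>+a. ennreal (measure M (rep a ` A - A)) \<partial>\<Lambda>)
      = ennreal \<kappa> * (\<integral>\<^sup>+a. ennreal (measure M (rep a ` A - A)) \<partial>\<Lambda>\<^sub>1)
        + ennreal (1 - \<kappa>) * (\<integral>\<^sup>+a. ennreal (measure M (rep a ` A - A)) \<partial>\<Lambda>\<^sub>2)"
  proof (rule nn_integral_mixture)
    fix B assume "B \<in> sets \<Lambda>"
    then show "emeasure \<Lambda> B = ennreal \<kappa> * emeasure \<Lambda>\<^sub>1 B + ennreal (1 - \<kappa>) * emeasure \<Lambda>\<^sub>2 B"
      using mix[of B] \<kappa>
      by (simp add: L.sets_law L.law.emeasure_eq_measure L1.law.emeasure_eq_measure
          L2.law.emeasure_eq_measure ennreal_mult ennreal_plus)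
  qed (use L.measurable_prob_leave[OF A] in \<open>simp_all add: L.sets_law L1.sets_law L2.sets_law\<close>)
  then have "ennreal (expansion M \<Lambda> A)
      = ennreal (\<kappa> * expansion M \<Lambda>\<^sub>1 A + (1 - \<kappa>) * expansion M \<Lambda>\<^sub>2 A)"
    using \<kappa> by (simp add: nn assms(1-3) ennreal_mult ennreal_plus
        L1.expansion_nonneg L2.expansion_nonneg)
  then show ?thesis
    using \<kappa> by (subst (asm) ennreal_inj)
      (auto simp: L.expansion_nonneg L1.expansion_nonneg L2.expansion_nonneg)
qed

subsection \<open>Restriction to an invariant set\<close>

context prob_space
begin

lemma space_normalized_restriction:
  "Y \<in> events \<Longrightarrow> space (normalized_restriction M Y) = Y"
  using sets.sets_into_space[of Y M]
  by (auto simp: normalized_restriction_def space_restrict_space space_scale_measure)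

lemma sets_normalized_restriction:
  "Y \<in> events \<Longrightarrow> A \<in> sets (normalized_restriction M Y) \<longleftrightarrow> A \<in> events \<and> A \<subseteq> Y"
  using sets.sets_into_space
  by (auto simp: normalized_restriction_def sets_restrict_space_iff Int_absorb2)

lemma emeasure_normalized_restriction:
  assumes "Y \<in> events" "A \<subseteq> Y"
  shows "emeasure (normalized_restriction M Y) A = 1 / emeasure M Y * emeasure M A"
  using assms by (simp add: normalized_restriction_def emeasure_restrict_space)

lemma measure_normalized_restriction:
  assumes "Y \<in> events" "A \<subseteq> Y"
  shows "measure (normalized_restriction M Y) A = prob A / prob Y"
proof -
  \<comment> \<open>If \<open>Y\<close> is null, both sides are 0: \<open>1 / 0\<close> is infinite
    in \<open>ennreal\<close> and \<open>enn2real\<close> sends it to 0, while \<open>1 / 0\<close>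
    is 0 in the reals.\<close>
  have "enn2real (1 / emeasure M Y) = 1 / prob Y"
  proof (cases "prob Y = 0")
    case False
    then have "1 / emeasure M Y = ennreal (1 / prob Y)"
      using divide_ennreal[of 1 "prob Y"] by (simp add: emeasure_eq_measure zero_less_measure_iff)
    then show ?thesis by simp
  qed (simp add: emeasure_eq_measure)
  then show ?thesis
    by (simp add: measure_def[of "normalized_restriction M Y"] emeasure_normalized_restriction[OF assms]
        enn2real_mult) (simp add: measure_def)
qed

lemma prob_space_normalized_restriction:
  assumes Y: "Y \<in> events" "0 < prob Y"
  shows "prob_space (normalized_restriction M Y)"
proof
  have "emeasure M Y \<noteq> 0" using Y(2) by (simp add: emeasure_eq_measure)
  then show "emeasure (normalized_restriction M Y) (space (normalized_restriction M Y)) = 1"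
    using Y(1) by (simp add: space_normalized_restriction emeasure_normalized_restriction
        ennreal_divide_times ennreal_divide_self less_top[symmetric])
qed

lemma null_sets_normalized_restriction:
  assumes Y: "Y \<in> events" "0 < prob Y"
  shows "E \<in> null_sets (normalized_restriction M Y) \<longleftrightarrow> E \<in> null_sets M \<and> E \<subseteq> Y"
proof -
  have "1 / emeasure M Y \<noteq> 0" by (simp add: ennreal_divide_eq_0_iff)
  then show ?thesis
    by (auto simp: null_sets_def sets_normalized_restriction Y emeasure_normalized_restriction)
qed

lemma AE_normalized_restriction:
  assumes Y: "Y \<in> events" "0 < prob Y"
  shows "(AE x in normalized_restriction M Y. P x) \<longleftrightarrow> (AE x in M. x \<in> Y \<longrightarrow> P x)"
proof
  assume "AE x in normalized_restriction M Y. P x"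
  then obtain E where E: "E \<in> null_sets M" "{x \<in> Y. \<not> P x} \<subseteq> E"
    by (auto simp: eventually_ae_filter null_sets_normalized_restriction[OF Y]
        space_normalized_restriction[OF Y(1)])
  then show "AE x in M. x \<in> Y \<longrightarrow> P x" by (intro AE_I'[OF E(1)]) auto
next
  assume "AE x in M. x \<in> Y \<longrightarrow> P x"
  then obtain E where E: "E \<in> null_sets M" "{x \<in> space M. \<not> (x \<in> Y \<longrightarrow> P x)} \<subseteq> E"
    by (auto simp: eventually_ae_filter)
  have "E \<inter> Y \<in> null_sets (normalized_restriction M Y)"
    using E(1) Y(1) by (simp add: null_sets_normalized_restriction[OF Y] null_set_Int2)
  then show "AE x in normalized_restriction M Y. P x"
    using E(2) sets.sets_into_space[OF Y(1)]
    by (intro AE_I') (auto simp: space_normalized_restriction[OF Y(1)])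
qed

lemma measurable_patch:
  assumes g: "g \<in> M \<rightarrow>\<^sub>M M" and Y: "Y \<in> events" and Y0: "Y0 \<in> events" "Y0 \<subseteq> Y" "g ` Y0 \<subseteq> Y0"
  defines "N \<equiv> normalized_restriction M Y"
  shows "(\<lambda>x. if x \<in> Y0 then g x else x) \<in> N \<rightarrow>\<^sub>M N"
proof (rule measurableI)
  fix x assume "x \<in> space N"
  then show "(if x \<in> Y0 then g x else x) \<in> space N"
    using Y0 Y by (auto simp: N_def space_normalized_restriction)
next
  fix A assume "A \<in> sets N"
  then have A: "A \<in> events" "A \<subseteq> Y" using Y by (auto simp: N_def sets_normalized_restriction)
  have eq: "(\<lambda>x. if x \<in> Y0 then g x else x) -` A \<inter> space N = (Y0 \<inter> (g -` A \<inter> space M)) \<union> (A - Y0)"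
    using Y0(2) A(2) Y sets.sets_into_space[OF Y]
    by (auto simp: N_def space_normalized_restriction split: if_splits)
  have "(Y0 \<inter> (g -` A \<inter> space M)) \<union> (A - Y0) \<in> events"
    using measurable_sets[OF g A(1)] A(1) Y0(1) by blast
  then show "(\<lambda>x. if x \<in> Y0 then g x else x) -` A \<inter> space N \<in> sets N"
    unfolding eq using A(2) Y0(2) Y by (auto simp: N_def sets_normalized_restriction)
qed

text \<open>The two sided orbits that stay in \<open>Y\<close> form a conull invariant part of \<open>Y\<close>, on which the
  restriction is given by \<open>g\<close>; elsewhere it is the identity.\<close>

lemma restriction_exists:
  assumes g: "g \<in> borel_isos M" and Y: "Y \<in> events" "0 < prob Y" and inv: "prob (g ` Y - Y) = 0"
  defines "N \<equiv> normalized_restriction M Y"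
  shows "\<exists>t\<in>borel_isos N. AE x in N. t x = g x"
proof -
  define gi where "gi = inv_into (space M) g"
  note gm [measurable] = iso_measurable[OF g]
  have gim [measurable]: "gi \<in> M \<rightarrow>\<^sub>M M" unfolding gi_def by (rule iso_inv_measurable[OF g])
  have gi_g: "gi (g x) = x" and g_gi: "g (gi x) = x" if "x \<in> space M" for x
    using that iso_bij[OF g] iso_inj[OF g]
    by (auto simp: gi_def bij_betw_def f_inv_into_f)
  have distr_gi: "distr M M gi = M"
  proof (rule measure_eqI)
    fix A assume "A \<in> sets (distr M M gi)"
    then have A: "A \<in> events" by simp
    have "g -` (gi -` A \<inter> space M) \<inter> space M = A"
      using sets.sets_into_space[OF A] measurable_space[OF gm] by (auto simp: gi_g)
    then show "emeasure (distr M M gi) A = emeasure M A"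
      using iso_emeasure_vimage[OF g measurable_sets[OF gim A]] A by (simp add: emeasure_distr)
  qed simp
  \<comment> \<open>By conservation of mass, \<open>inv\<close> yields both equations: if almost
    nothing leaves \<open>Y\<close>, almost nothing enters it.\<close>
  have "prob {x \<in> Y. g x \<notin> Y} = 0" "prob {x \<in> space M. x \<notin> Y \<and> g x \<in> Y} = 0"
    using inv iso_measure_leave[OF g Y(1)] by simp_all
  moreover have "{x \<in> Y. g x \<notin> Y} = {x \<in> space M. x \<in> Y \<and> g x \<notin> Y}"
    using sets.sets_into_space[OF Y(1)] by auto
  ultimately have "AE x in M. \<not> (x \<in> Y \<and> g x \<notin> Y)" "AE x in M. \<not> (x \<notin> Y \<and> g x \<in> Y)"
    using Y(1) by (auto simp: AE_iff_measurable[OF _ refl] emeasure_eq_measure)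
  then have fwd: "AE x in M. x \<in> Y \<longrightarrow> g x \<in> Y" and bck: "AE x in M. g x \<in> Y \<longrightarrow> x \<in> Y"
    by auto
  have "AE x in M. g (gi x) \<in> Y \<longrightarrow> gi x \<in> Y"
    using bck by (intro AE_distrD[OF gim]) (simp only: distr_gi)
  then have bwd: "AE x in M. x \<in> Y \<longrightarrow> gi x \<in> Y"
    using AE_space by eventually_elim (simp add: g_gi)
  \<comment> \<open>A measure preserving \<open>s\<close> pulls conull sets back to conull sets, so
    the property passes from \<open>n\<close> to \<open>Suc n\<close>.\<close>
  have iter: "AE x in M. x \<in> Y \<longrightarrow> (s ^^ n) x \<in> Y"
    if s: "s \<in> M \<rightarrow>\<^sub>M M" "distr M M s = M" "AE x in M. x \<in> Y \<longrightarrow> s x \<in> Y" for s and n :: nat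
  proof (induction n)
    case (Suc n)
    have "AE x in M. s x \<in> Y \<longrightarrow> (s ^^ n) (s x) \<in> Y"
      using Suc by (intro AE_distrD[OF s(1)]) (simp only: s(2))
    then show ?case using s(3) by eventually_elim (simp add: funpow_Suc_right del: funpow.simps)
  qed simp
  define Y0 where "Y0 = {x \<in> Y. \<forall>n. (g ^^ n) x \<in> Y \<and> (gi ^^ n) x \<in> Y}"
  have pow_meas: "s ^^ n \<in> M \<rightarrow>\<^sub>M M" if "s \<in> M \<rightarrow>\<^sub>M M" for s :: "'a \<Rightarrow> 'a" and n :: nat
    by (induction n) (auto intro: measurable_compose[OF _ that])
  note [measurable] = pow_meas[OF gm] pow_meas[OF gim]
  have "Y0 = {x \<in> space M. x \<in> Y \<and> (\<forall>n. (g ^^ n) x \<in> Y \<and> (gi ^^ n) x \<in> Y)}"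
    using sets.sets_into_space[OF Y(1)] by (auto simp: Y0_def)
  then have Y0_ev: "Y0 \<in> events" using Y(1) by simp
  have Y0_Y: "Y0 \<subseteq> Y" by (auto simp: Y0_def)
  then have Y0_sp: "x \<in> space M" if "x \<in> Y0" for x
    using that sets.sets_into_space[OF Y(1)] by auto
  have Y0_ae: "AE x in M. x \<in> Y \<longrightarrow> x \<in> Y0"
  proof -
    have "AE x in M. \<forall>n. (x \<in> Y \<longrightarrow> (g ^^ n) x \<in> Y) \<and> (x \<in> Y \<longrightarrow> (gi ^^ n) x \<in> Y)"
      using iter[OF gm iso_distr[OF g] fwd] iter[OF gim distr_gi bwd]
      by (simp add: AE_all_countable)
    then show ?thesis by eventually_elim (auto simp: Y0_def)
  qed
  \<comment> \<open>Stated for a map \<open>s\<close> with left inverse \<open>si\<close>, so that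
    it serves for \<open>g\<close> and, with the roles exchanged, for \<open>gi\<close>.\<close>
  have step: "s x \<in> Y0'"
    if "x \<in> Y0'" "x \<in> space M" "\<And>y. y \<in> space M \<Longrightarrow> si (s y) = y"
      and Y0': "Y0' = {x \<in> Y. \<forall>n. (s ^^ n) x \<in> Y \<and> (si ^^ n) x \<in> Y}" for s si :: "'a \<Rightarrow> 'a" and x Y0'
  proof -
    have p: "(s ^^ n) x \<in> Y" "(si ^^ n) x \<in> Y" for n using that(1) unfolding Y0' by auto
    have fwd: "(s ^^ n) (s x) \<in> Y" for n
      using p(1)[of "Suc n"] by (simp add: funpow_Suc_right del: funpow.simps)
    have "(si ^^ n) (s x) \<in> Y" for n
    proof (cases n)
      case 0
      then show ?thesis using p(1)[of 1] by simp
    next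
      case (Suc k)
      then show ?thesis
        using p(2)[of k] that(2,3) by (simp add: funpow_Suc_right del: funpow.simps)
    qed
    then show ?thesis unfolding Y0' using fwd fwd[of 0] by simp
  qed
  have g_Y0: "g x \<in> Y0" if "x \<in> Y0" for x
    by (rule step[of x Y0 gi g, OF that Y0_sp[OF that] gi_g Y0_def])
  have gi_Y0: "gi x \<in> Y0" if "x \<in> Y0" for x
  proof (rule step[of x Y0 g gi, OF that Y0_sp[OF that] g_gi])
    show "Y0 = {x \<in> Y. \<forall>n. (gi ^^ n) x \<in> Y \<and> (g ^^ n) x \<in> Y}" by (auto simp: Y0_def)
  qed
  define t where "t x = (if x \<in> Y0 then g x else x)" for x
  define ti where "ti x = (if x \<in> Y0 then gi x else x)" for x
  have t_ti: "t (ti x) = x" "ti (t x) = x" for x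
    using g_Y0[of x] gi_Y0[of x] gi_g[of x] g_gi[of x] Y0_sp[of x]
    by (cases "x \<in> Y0"; simp add: t_def ti_def)+
  have space_N: "space N = Y" unfolding N_def by (rule space_normalized_restriction[OF Y(1)])
  have tN: "t \<in> N \<rightarrow>\<^sub>M N"
    unfolding N_def t_def[abs_def]
    by (rule measurable_patch[OF gm Y(1) Y0_ev Y0_Y]) (use g_Y0 in blast)
  have tiN: "ti \<in> N \<rightarrow>\<^sub>M N"
    unfolding N_def ti_def[abs_def]
    by (rule measurable_patch[OF gim Y(1) Y0_ev Y0_Y]) (use gi_Y0 in blast)
  have bij: "bij_betw t (space N) (space N)"
    using measurable_space[OF tN] measurable_space[OF tiN]
    by (intro bij_betw_byWitness[where f' = ti]) (auto simp: t_ti)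
  have "inv_into (space N) t x = ti x" if "x \<in> space N" for x
    using measurable_space[OF tiN that] bij t_ti
    by (intro inv_into_f_eq) (auto simp: bij_betw_def)
  then have inv_t: "inv_into (space N) t \<in> N \<rightarrow>\<^sub>M N"
    using tiN by (simp cong: measurable_cong)
  have "distr N N t = N"
  proof (rule measure_eqI)
    fix A assume "A \<in> sets (distr N N t)"
    then have A: "A \<in> sets N" "A \<in> events" "A \<subseteq> Y"
      using Y(1) by (auto simp: N_def sets_normalized_restriction)
    have pre: "t -` A \<inter> Y \<in> sets N" using measurable_sets[OF tN A(1)] by (simp add: space_N)
    then have pre': "t -` A \<inter> Y \<in> events" using Y(1) by (simp add: N_def sets_normalized_restriction)
    \<comment> \<open>\<open>bck\<close> takes care of the points outside \<open>Y\<close> that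
      \<open>g\<close> sends into \<open>A\<close>; \<open>Y0_ae\<close> of those where
      \<open>t\<close> is the identity.\<close>
    have "emeasure M (t -` A \<inter> Y) = emeasure M (g -` A \<inter> space M)"
    proof (rule emeasure_eq_AE)
      show "AE x in M. x \<in> t -` A \<inter> Y \<longleftrightarrow> x \<in> g -` A \<inter> space M"
        using AE_space Y0_ae bck by eventually_elim (use A(3) in \<open>auto simp: t_def\<close>)
    qed (use pre' measurable_sets[OF gm A(2)] in auto)
    also have "\<dots> = emeasure M A" by (rule iso_emeasure_vimage[OF g A(2)])
    finally show "emeasure (distr N N t) A = emeasure N A"
      using tN A Y(1)
      by (simp add: emeasure_distr space_N) (simp add: N_def emeasure_normalized_restriction)
  qed simp
  then have "t \<in> borel_isos N" using tN bij inv_t by (simp add: borel_isos_def)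
  moreover have "AE x in N. t x = g x"
    unfolding N_def AE_normalized_restriction[OF Y]
    using Y0_ae by eventually_elim (simp add: t_def)
  ultimately show ?thesis by blast
qed

end

section \<open>Restricted automorphisms and the restricted law\<close>

context aut_law
begin

text \<open>\<open>restriction_exists\<close> makes the class nonempty, so it is a full equivalence
  class. Since \<open>rep\<close> may pick any member, agreement with \<open>rep a\<close> can only
  be claimed almost everywhere.\<close>

lemma
  fixes Y a
  defines "N \<equiv> normalized_restriction M Y" and "b \<equiv> restrict_aut M Y a"
  assumes Y: "Y \<in> events" "0 < prob Y" and a: "a \<in> Aut M" "prob (rep a ` Y - Y) = 0"
  shows restrict_aut_in_Aut: "b \<in> Aut N"
    and rep_restrict_aut: "AE x in N. rep b x = rep a x"
proof -
  obtain t where t: "t \<in> borel_isos N" "AE x in N. t x = rep a x"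
    using restriction_exists[OF rep_borel_isos[OF a(1)] Y a(2)] unfolding N_def by blast
  have "b = ae_equal N `` {t}"
  proof (intro equalityI subsetI)
    fix s assume "s \<in> b"
    then have s: "s \<in> borel_isos N" "AE x in N. s x = rep a x"
      unfolding b_def restrict_aut_def N_def by auto
    have "AE x in N. t x = s x" using t(2) s(2) by eventually_elim simp
    then show "s \<in> ae_equal N `` {t}" using t s by (simp add: ae_equal_def)
  next
    fix s assume "s \<in> ae_equal N `` {t}"
    then have s: "s \<in> borel_isos N" "AE x in N. t x = s x" by (auto simp: ae_equal_def)
    have "AE x in N. s x = rep a x" using t(2) s(2) by eventually_elim simp
    then show "s \<in> b" using s(1) unfolding b_def restrict_aut_def N_def by simp
  qed
  then show b: "b \<in> Aut N" unfolding Aut_def using t(1) by (simp add: quotientI)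
  show "AE x in N. rep b x = rep a x"
    using rep_in_class[OF b] unfolding b_def restrict_aut_def N_def by simp
qed

context
  fixes Y N S
  assumes Y: "invariant_set M \<Lambda> Y" "0 < prob Y"
  defines "N \<equiv> normalized_restriction M Y"
    and "S \<equiv> {a \<in> Aut M. prob (rep a ` Y - Y) = 0}"
begin

lemma Y_event: "Y \<in> events"
  using Y(1) by (simp add: invariant_set_def)

lemma prob_space_N: "prob_space N"
  unfolding N_def by (rule prob_space_normalized_restriction[OF Y_event Y(2)])

lemma restrict_aut_Aut: "a \<in> S \<Longrightarrow> restrict_aut M Y a \<in> Aut N"
  unfolding N_def S_def using restrict_aut_in_Aut[OF Y_event Y(2)] by simp

text \<open>Measures do not see the null set on which the chosen representatives differ. Symmetric
  differences and expansions are both computed from these numbers, so they scale by the same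
  factor.\<close>

lemma measure_rep_restrict_aut:
  assumes a: "a \<in> S" and A: "A \<in> sets N" and Z: "Z \<in> sets N"
  shows "measure N {x \<in> A. rep (restrict_aut M Y a) x \<in> Z} = prob {x \<in> A. rep a x \<in> Z} / prob Y"
proof -
  let ?s = "rep (restrict_aut M Y a)"
  have AZ: "A \<in> events" "A \<subseteq> Y" "Z \<in> events" "Z \<subseteq> Y"
    using A Z Y_event by (auto simp: N_def sets_normalized_restriction)
  have aM: "a \<in> Aut M" using a by (simp add: S_def)
  have s: "{x \<in> A. ?s x \<in> Z} \<in> sets N"
    by (rule sets_Collect_iso[OF rep_borel_isos[OF restrict_aut_Aut[OF a]] A Z])
  then have s': "{x \<in> A. ?s x \<in> Z} \<in> events" using Y_event by (simp add: N_def sets_normalized_restriction)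
  have "AE x in M. x \<in> Y \<longrightarrow> ?s x = rep a x"
    using rep_restrict_aut[OF Y_event Y(2)] a
    by (simp add: S_def AE_normalized_restriction[OF Y_event Y(2)])
  then have "prob {x \<in> A. ?s x \<in> Z} = prob {x \<in> A. rep a x \<in> Z}"
    using s' sets_Collect_iso[OF rep_borel_isos[OF aM] AZ(1,3)] AZ(2)
    by (intro measure_eq_AE) (auto elim!: eventually_mono)
  then show ?thesis
    using AZ(2) by (simp add: N_def measure_normalized_restriction[OF Y_event] subset_eq)
qed

lemma measure_sym_diff_restrict_aut:
  assumes a: "a \<in> S" and A: "A \<in> sets N" and Z: "Z \<in> sets N"
  shows "measure N (sym_diff (rep (restrict_aut M Y a) ` A) Z) = prob (sym_diff (rep a ` A) Z) / prob Y"
proof -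
  interpret N: prob_space N by (rule prob_space_N)
  have AZ: "A \<in> events" "A \<subseteq> Y" "Z \<in> events" "Z \<subseteq> Y"
    using A Z Y_event by (auto simp: N_def sets_normalized_restriction)
  have aM: "a \<in> Aut M" using a by (simp add: S_def)
  have "measure N A = prob A / prob Y" "measure N Z = prob Z / prob Y"
    unfolding N_def using AZ by (simp_all add: measure_normalized_restriction[OF Y_event])
  then show ?thesis
    unfolding N.iso_measure_sym_diff[OF rep_borel_isos[OF restrict_aut_Aut[OF a]] A Z]
      iso_measure_sym_diff[OF rep_borel_isos[OF aM] AZ(1,3)] measure_rep_restrict_aut[OF a A Z]
    by (simp add: add_divide_distrib diff_divide_distrib)
qed

lemma measure_leave_restrict_aut:
  assumes a: "a \<in> S" and A: "A \<in> sets N"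
  shows "measure N (rep (restrict_aut M Y a) ` A - A) = prob (rep a ` A - A) / prob Y"
proof -
  interpret N: prob_space N by (rule prob_space_N)
  have A': "A \<in> events" "A \<subseteq> Y"
    using A Y_event by (auto simp: N_def sets_normalized_restriction)
  have aM: "a \<in> Aut M" using a by (simp add: S_def)
  have "measure N A = prob A / prob Y"
    unfolding N_def using A' by (simp add: measure_normalized_restriction[OF Y_event])
  then show ?thesis
    unfolding N.iso_measure_image_Diff[OF rep_borel_isos[OF restrict_aut_Aut[OF a]] A A]
      iso_measure_image_Diff[OF rep_borel_isos[OF aM] A'(1) A'(1)] measure_rep_restrict_aut[OF a A A]
    by (simp add: diff_divide_distrib)
qed

text \<open>Continuity makes the preimage of every open set measurable without a countable base of the
  weak topology.\<close>

lemma restrict_aut_continuous: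
  assumes "openin (weak_topology N) U"
  shows "\<exists>V. openin (weak_topology M) V \<and> {a \<in> S. restrict_aut M Y a \<in> U} = V \<inter> S"
proof -
  have "generate_topology_on {{b \<in> Aut N. measure N (sym_diff (rep b ` A) Z) < \<epsilon>} | A Z \<epsilon>.
      A \<in> sets N \<and> Z \<in> sets N \<and> \<epsilon> > 0} U"
    using assms by (simp add: weak_topology_def openin_topology_generated_by_iff)
  then show ?thesis
  proof induction
    case Empty
    show ?case by (intro exI[of _ "{}"]) simp
  next
    case (Int U1 U2)
    then obtain V1 V2 where "openin (weak_topology M) V1" "{a \<in> S. restrict_aut M Y a \<in> U1} = V1 \<inter> S"
      "openin (weak_topology M) V2" "{a \<in> S. restrict_aut M Y a \<in> U2} = V2 \<inter> S" by blast
    then show ?case by (intro exI[of _ "V1 \<inter> V2"]) (blast intro: openin_Int)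
  next
    case (UN K)
    then have "\<forall>k\<in>K. \<exists>V. openin (weak_topology M) V \<and> {a \<in> S. restrict_aut M Y a \<in> k} = V \<inter> S"
      by blast
    from bchoice[OF this] obtain V where V: "\<And>k. k \<in> K \<Longrightarrow> openin (weak_topology M) (V k)"
      "\<And>k. k \<in> K \<Longrightarrow> {a \<in> S. restrict_aut M Y a \<in> k} = V k \<inter> S" by blast
    have "{a \<in> S. restrict_aut M Y a \<in> \<Union>K} = (\<Union>k\<in>K. {a \<in> S. restrict_aut M Y a \<in> k})" by blast
    also have "\<dots> = (\<Union>k\<in>K. V k) \<inter> S" using V(2) by blast
    finally show ?case using V(1) by (intro exI[of _ "\<Union>k\<in>K. V k"]) (auto intro: openin_Union)
  next
    case (Basis U)
    then obtain A Z \<epsilon> where U: "U = {b \<in> Aut N. measure N (sym_diff (rep b ` A) Z) < \<epsilon>}"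
      and AZ: "A \<in> sets N" "Z \<in> sets N" "0 < \<epsilon>" by blast
    have AZ': "A \<in> events" "Z \<in> events"
      using AZ Y_event by (auto simp: N_def sets_normalized_restriction)
    \<comment> \<open>The radius is rescaled by \<open>prob Y\<close> to undo the normalization of
      the measure on \<open>Y\<close>.\<close>
    let ?V = "{a \<in> Aut M. prob (sym_diff (rep a ` A) Z) < \<epsilon> * prob Y}"
    have "openin (weak_topology M) ?V"
      using AZ AZ' Y(2) by (intro openin_weak_subbasis) auto
    moreover have "{a \<in> S. restrict_aut M Y a \<in> U} = ?V \<inter> S"
    proof -
      have "restrict_aut M Y a \<in> U \<longleftrightarrow> prob (sym_diff (rep a ` A) Z) < \<epsilon> * prob Y" if "a \<in> S" for a
        using measure_sym_diff_restrict_aut[OF that AZ(1,2)] restrict_aut_Aut[OF that] Y(2)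
        by (simp add: U divide_less_eq)
      then show ?thesis by (auto simp: S_def)
    qed
    ultimately show ?case by blast
  qed
qed

lemma S_sets: "S \<in> sets \<Lambda>"
proof -
  have "{a \<in> space \<Lambda>. prob (rep a ` Y - Y) = 0} \<in> sets \<Lambda>"
    using measurable_prob_leave[OF Y_event] by measurable
  then show ?thesis by (simp add: S_def space_law)
qed

lemma AE_S: "AE a in \<Lambda>. a \<in> S"
proof -
  have "AE a in \<Lambda>. prob (rep a ` Y - Y) = 0"
    using Y(1) integral_nonneg_eq_0_iff_AE[OF integrable_prob_leave[OF Y_event]]
    by (simp add: invariant_set_def expansion_def)
  then show ?thesis using AE_space by eventually_elim (simp add: S_def space_law)
qed

lemma space_restrict_S: "space (restrict_space \<Lambda> S) = S"
  using sets.sets_into_space[OF S_sets] by (auto simp: space_restrict_space)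

lemma restrict_aut_measurable: "restrict_aut M Y \<in> restrict_space \<Lambda> S \<rightarrow>\<^sub>M Aut_borel N"
  unfolding Aut_borel_def
proof (rule measurable_measure_of)
  show "{U. openin (weak_topology N) U} \<subseteq> Pow (Aut N)"
    using openin_subset topspace_weak_topology by blast
  show "restrict_aut M Y \<in> space (restrict_space \<Lambda> S) \<rightarrow> Aut N"
    using restrict_aut_Aut by (auto simp: space_restrict_S)
  fix U assume "U \<in> {U. openin (weak_topology N) U}"
  then obtain V where V: "openin (weak_topology M) V" "{a \<in> S. restrict_aut M Y a \<in> U} = V \<inter> S"
    using restrict_aut_continuous by auto
  have "restrict_aut M Y -` U \<inter> space (restrict_space \<Lambda> S) = V \<inter> S"
    unfolding space_restrict_S V(2)[symmetric] by auto
  then show "restrict_aut M Y -` U \<inter> space (restrict_space \<Lambda> S) \<in> sets (restrict_space \<Lambda> S)"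
    using openin_weak_sets[OF V(1)] S_sets by (auto simp: sets_restrict_space_iff sets_law)
qed

lemma restrict_law_eq:
  "restrict_law M Y \<Lambda> = distr (restrict_space \<Lambda> S) (Aut_borel N) (restrict_aut M Y)"
  by (simp add: restrict_law_def N_def S_def)

text \<open>\<open>S\<close> has full measure, so restricting \<open>\<Lambda>\<close> to it gives a
  probability measure again.\<close>

lemma aut_law_restriction: "aut_law N (restrict_law M Y \<Lambda>)"
proof -
  have "emeasure \<Lambda> S = 1"
    using AE_S S_sets law.emeasure_eq_1_AE by blast
  then have "prob_space (restrict_space \<Lambda> S)"
    using S_sets by (intro prob_space_restrict_space) auto
  then have "prob_space (restrict_law M Y \<Lambda>)"
    unfolding restrict_law_eq by (rule prob_space.prob_space_distr[OF _ restrict_aut_measurable])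
  then show ?thesis
    using prob_space_N by (simp add: aut_law_def aut_law_axioms_def restrict_law_eq)
qed

text \<open>The measure of a subset of \<open>Y\<close> is divided by \<open>prob Y\<close> as well,
  so ratios of expansion to measure do not change under restriction.\<close>

lemma expansion_restriction:
  assumes A: "A \<in> sets N"
  shows "expansion N (restrict_law M Y \<Lambda>) A = expansion M \<Lambda> A / prob Y"
proof -
  interpret R: aut_law N "restrict_law M Y \<Lambda>" by (rule aut_law_restriction)
  have A': "A \<in> events" using A Y_event by (auto simp: N_def sets_normalized_restriction)
  have "(\<lambda>b. measure N (rep b ` A - A)) \<in> borel_measurable (Aut_borel N)"
    using R.measurable_prob_leave[OF A] by (simp add: measurable_cong_sets[OF R.sets_law refl])
  then have "expansion N (restrict_law M Y \<Lambda>) A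
      = (\<integral>a. measure N (rep (restrict_aut M Y a) ` A - A) \<partial>restrict_space \<Lambda> S)"
    unfolding expansion_def restrict_law_eq by (rule integral_distr[OF restrict_aut_measurable])
  also have "\<dots> = (\<integral>a. prob (rep a ` A - A) / prob Y \<partial>restrict_space \<Lambda> S)"
    by (intro Bochner_Integration.integral_cong refl)
      (simp add: space_restrict_S measure_leave_restrict_aut A)
  also have "\<dots> = (\<integral>a. indicator S a *\<^sub>R (prob (rep a ` A - A) / prob Y) \<partial>\<Lambda>)"
    using S_sets by (intro integral_restrict_space) auto
  also have "\<dots> = (\<integral>a. prob (rep a ` A - A) / prob Y \<partial>\<Lambda>)"
  proof (rule integral_cong_AE)
    show "AE a in \<Lambda>. indicator S a *\<^sub>R (prob (rep a ` A - A) / prob Y) = prob (rep a ` A - A) / prob Y"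
      using AE_S by eventually_elim simp
  qed (use measurable_prob_leave[OF A'] S_sets in measurable)
  finally show ?thesis by (simp add: expansion_def)
qed

end

end

subsection \<open>Almost invariant sets\<close>

text \<open>Completeness of the measure algebra along a fast sequence. \<open>L\<close> is the limit
  superior; a point in exactly one of \<open>L\<close> and \<open>B n\<close> changes its membership
  at some step from \<open>n\<close> on, and these changes have geometrically small total
  measure.\<close>

lemma (in prob_space) prob_sym_diff_limit:
  assumes B [measurable]: "\<And>n. B n \<in> events"
    and step: "\<And>n. prob (sym_diff (B n) (B (Suc n))) \<le> K * (1/2) ^ n"
  obtains L where "L \<in> events" "(\<lambda>n. prob (sym_diff L (B n))) \<longlonglongrightarrow> 0"
proof -
  define L where "L = (\<Inter>n. \<Union>m. B (n + m))"
  have L: "L \<in> events" unfolding L_def by measurable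
  have sub: "sym_diff L (B n) \<subseteq> (\<Union>k. sym_diff (B (n + k)) (B (Suc (n + k))))" for n
  proof
    fix x assume x: "x \<in> sym_diff L (B n)"
    show "x \<in> (\<Union>k. sym_diff (B (n + k)) (B (Suc (n + k))))"
    proof (rule ccontr)
      assume "\<not> ?thesis"
      then have const: "x \<in> B (n + k) \<longleftrightarrow> x \<in> B (Suc (n + k))" for k by blast
      have same: "x \<in> B (n + k) \<longleftrightarrow> x \<in> B n" for k
        by (induction k) (use const in auto)
      show False
      proof (cases "x \<in> B n")
        case True
        then have "x \<in> B (k + n)" for k using same[of k] by (simp add: add.commute)
        then have "x \<in> L" unfolding L_def by blast
        then show False using x True by blast
      next
        case False
        then have "x \<notin> L" using same unfolding L_def by blast
        then show False using x False by blast
      qed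
    qed
  qed
  have bound: "prob (sym_diff L (B n)) \<le> 2 * K * (1/2) ^ n" for n
  proof -
    let ?D = "\<lambda>k. sym_diff (B (n + k)) (B (Suc (n + k)))"
    have le: "prob (?D k) \<le> K * (1/2) ^ n * (1/2) ^ k" for k
      using step[of "n + k"] by (simp add: power_add mult.assoc)
    have sumK: "(\<lambda>k. K * (1/2) ^ n * (1/2) ^ k) sums (K * (1/2) ^ n * 2)"
      using sums_mult[OF geometric_sums[of "1/2 :: real"], of "K * (1/2) ^ n"] by simp
    have summ: "summable (\<lambda>k. prob (?D k))"
      by (rule summable_comparison_test'[OF sums_summable[OF sumK]]) (use le in simp)
    have "prob (sym_diff L (B n)) \<le> prob (\<Union>k. ?D k)"
      using sub by (intro finite_measure_mono) auto
    also have "\<dots> \<le> (\<Sum>k. prob (?D k))"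
      using summ by (intro finite_measure_subadditive_countably) auto
    also have "\<dots> \<le> (\<Sum>k. K * (1/2) ^ n * (1/2) ^ k)"
      using le summ sums_summable[OF sumK] by (intro suminf_le)
    also have "\<dots> = 2 * K * (1/2) ^ n" using sums_unique[OF sumK] by simp
    finally show ?thesis .
  qed
  have "(\<lambda>n. 2 * K * (1/2) ^ n) \<longlonglongrightarrow> 2 * K * 0"
    by (intro tendsto_mult_left LIMSEQ_power_zero) simp
  then have lim0: "(\<lambda>n. 2 * K * (1/2) ^ n) \<longlonglongrightarrow> 0" by simp
  have "(\<lambda>n. prob (sym_diff L (B n))) \<longlonglongrightarrow> 0"
  proof (rule Lim_null_comparison[OF _ lim0], rule always_eventually, rule allI)
    show "norm (prob (sym_diff L (B n))) \<le> 2 * K * (1/2) ^ n" for n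
      using bound[of n] by (simp only: real_norm_def abs_of_nonneg measure_nonneg)
  qed
  then show ?thesis by (rule that[OF L])
qed

lemma (in prob_space) prob_sym_diff:
  assumes "A \<in> events" "B \<in> events"
  shows "prob (sym_diff A B) = prob A + prob B - 2 * prob (A \<inter> B)"
proof -
  have "prob (sym_diff A B) = prob (A - B) + prob (B - A)"
    using assms by (intro finite_measure_Union) auto
  then show ?thesis
    using finite_measure_Diff'[OF assms] finite_measure_Diff'[OF assms(2,1)]
    by (simp add: Int_commute)
qed

text \<open>From a suitable index \<open>p\<close> on, each new set meets the union of its
  predecessors in measure at most \<open>d / 2\<close>, by a geometric sum, and so adds at least
  \<open>d / 2\<close> to it; eventually the total would exceed 1.\<close>

lemma (in prob_space) no_almost_disjoint_sequence:
  assumes B [measurable]: "\<And>n. B n \<in> events" and d: "0 < d" "\<And>n. d \<le> prob (B n)"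
    and small: "\<And>i j. i < j \<Longrightarrow> prob (B i \<inter> B j) \<le> K * (1/2) ^ i"
  shows False
proof -
  have "(\<lambda>p. 2 * K * (1/2) ^ p) \<longlonglongrightarrow> 2 * K * 0"
    by (intro tendsto_mult_left LIMSEQ_power_zero) simp
  then have "\<forall>\<^sub>F p in sequentially. 2 * K * (1/2) ^ p < d / 2"
    using d(1) by (intro order_tendstoD) auto
  then obtain p where p: "2 * K * (1/2) ^ p < d / 2"
    by (auto simp: eventually_sequentially)
  have "K * (1/2) ^ 0 \<ge> prob (B 0 \<inter> B 1)" by (rule small) simp
  then have K: "0 \<le> K" by (simp add: order_trans[OF measure_nonneg])
  have "n * (d / 2) \<le> prob (\<Union>i<n. B (p + i))" for n
  proof (induction n)
    case (Suc n)
    let ?U = "\<Union>i<n. B (p + i)"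
    have "prob (?U \<inter> B (p + n)) \<le> prob (\<Union>i\<in>{..<n}. B (p + i) \<inter> B (p + n))"
      by (intro finite_measure_mono) auto
    also have "\<dots> \<le> (\<Sum>i<n. prob (B (p + i) \<inter> B (p + n)))"
      by (intro finite_measure_subadditive_finite) auto
    also have "\<dots> \<le> (\<Sum>i<n. K * (1/2) ^ p * (1/2) ^ i)"
      using small[of "p + i" "p + n" for i] by (intro sum_mono) (simp add: power_add mult.assoc)
    also have "\<dots> = K * (1/2) ^ p * (\<Sum>i<n. (1/2) ^ i)"
      by (simp add: sum_distrib_left)
    also have "\<dots> \<le> K * (1/2) ^ p * 2"
    proof (intro mult_left_mono)
      have "(\<Sum>i<n. (1/2 :: real) ^ i) = ((1/2) ^ n - 1) / (1/2 - 1)"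
        by (rule geometric_sum) simp
      then show "(\<Sum>i<n. (1/2 :: real) ^ i) \<le> 2" by simp
    qed (use K in simp)
    finally have meet: "prob (?U \<inter> B (p + n)) \<le> d / 2" using p by simp
    have "{..<Suc n} = insert n {..<n}" by auto
    then have "prob (\<Union>i<Suc n. B (p + i)) = prob (?U \<union> B (p + n))"
      by (simp add: Un_commute)
    also have "\<dots> = prob ?U + prob (B (p + n)) - prob (?U \<inter> B (p + n))"
      using measure_Un3[of ?U M "B (p + n)"] by (simp add: fmeasurable_eq_sets)
    finally show ?case using Suc meet d(2)[of "p + n"] by (simp add: field_simps)
  qed simp
  moreover obtain n :: nat where "1 < n * (d / 2)"
    using reals_Archimedean3[of "d / 2"] d(1) by (metis half_gt_zero)
  ultimately show False
    by (meson linorder_not_le order_trans prob_le_1)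
qed

context aut_law
begin

text \<open>If sets of measure at most \<open>1/2\<close> did not expand uniformly, there would be almost invariant
  sets \<open>A n\<close> of measure between \<open>d\<close> and \<open>1/2\<close>. Choose them of asymptotically minimal measure. Then
  the almost invariant set \<open>A i \<inter> A j\<close> is either negligible or nearly all of \<open>A i\<close> and \<open>A j\<close>.
  The first case cannot hold for infinitely many pairwise indices, so by Ramsey's theorem some
  subsequence converges in the measure algebra, to an invariant set.\<close>

lemma ergodic_small_set_expansion:
  assumes erg: "\<And>Z. invariant_set M \<Lambda> Z \<Longrightarrow> prob Z = 0 \<or> prob Z = 1"
    and d: "0 < d" and C: "0 \<le> C"
    and small: "\<And>A. A \<in> events \<Longrightarrow> prob A \<le> d \<Longrightarrow> prob A \<le> C * expansion M \<Lambda> A"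
  shows "\<exists>\<eta>>0. \<forall>A\<in>events. prob A \<le> 1/2 \<longrightarrow> \<eta> * prob A \<le> expansion M \<Lambda> A"
proof (rule ccontr)
  assume "\<not> ?thesis"
  then have neg: "\<exists>A\<in>events. prob A \<le> 1/2 \<and> expansion M \<Lambda> A < \<eta> * prob A" if "0 < \<eta>" for \<eta>
    using that by (meson not_le)
  define \<A> where "\<A> \<eta> = {A \<in> events. expansion M \<Lambda> A \<le> \<eta> \<and> d < prob A \<and> prob A \<le> 1/2}" for \<eta>
  define m where "m \<eta> = Inf (prob ` \<A> \<eta>)" for \<eta>
  have ne: "\<A> \<eta> \<noteq> {}" if "0 < \<eta>" for \<eta>
  proof -
    \<comment> \<open>The bound \<open>1 / (C + 1)\<close> rules out \<open>prob A \<le> d\<close>: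
      there \<open>small\<close> would give
      \<open>prob A \<le> C / (C + 1) * prob A\<close>.\<close>
    obtain A where A: "A \<in> events" "prob A \<le> 1/2" "expansion M \<Lambda> A < min \<eta> (1 / (C + 1)) * prob A"
      using neg[of "min \<eta> (1 / (C + 1))"] \<open>0 < \<eta>\<close> C by auto
    have pos: "0 < prob A"
      using A(3) expansion_nonneg[of A] by (metis mult_zero_right not_le zero_less_measure_iff)
    have "min \<eta> (1 / (C + 1)) * prob A \<le> \<eta> * prob A"
      and "min \<eta> (1 / (C + 1)) * prob A \<le> 1 / (C + 1) * prob A"
      using pos by (intro mult_right_mono; simp)+
    then have e: "expansion M \<Lambda> A < \<eta> * prob A" "expansion M \<Lambda> A < 1 / (C + 1) * prob A"
      using A(3) by linarith+
    moreover have "\<eta> * prob A \<le> \<eta> * 1" using \<open>0 < \<eta>\<close> by (intro mult_left_mono) auto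
    moreover have "d < prob A"
    proof (rule ccontr)
      assume "\<not> d < prob A"
      then have "prob A \<le> C * expansion M \<Lambda> A" using small A(1) by simp
      also have "\<dots> \<le> C * (1 / (C + 1) * prob A)"
        using C e(2) by (intro mult_left_mono) auto
      also have "\<dots> < prob A" using C pos by (simp add: field_simps)
      finally show False by simp
    qed
    ultimately show ?thesis using A by (auto simp: \<A>_def intro!: exI[of _ A])
  qed
  have bdd: "bdd_below (prob ` \<A> \<eta>)" for \<eta> by (rule bdd_belowI[of _ 0]) auto
  have m_le: "m \<eta> \<le> prob A" if "A \<in> \<A> \<eta>" for A \<eta>
    unfolding m_def using that bdd by (intro cInf_lower) auto
  have m_anti: "m \<eta>' \<le> m \<eta>" if "0 < \<eta>" "\<eta> \<le> \<eta>'" for \<eta> \<eta>'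
    unfolding m_def using that ne[OF that(1)] bdd
    by (intro cInf_superset_mono) (auto simp: \<A>_def)
  have m_half: "m \<eta> \<le> 1/2" if pos: "0 < \<eta>" for \<eta>
  proof -
    obtain A where "A \<in> \<A> \<eta>" using ne[OF pos] by blast
    then show ?thesis using m_le[of A \<eta>] by (auto simp: \<A>_def)
  qed
  \<comment> \<open>\<open>m\<close> is antitone, so \<open>s\<close> is its limit as
    \<open>\<eta>\<close> tends to 0: the asymptotically least measure of almost invariant sets
    above \<open>d\<close>.\<close>
  define s where "s = Sup (m ` {0<..})"
  have bdds: "bdd_above (m ` {0<..})" using m_half by (intro bdd_aboveI[of _ "1/2"]) auto
  have m_s: "m \<eta> \<le> s" if "0 < \<eta>" for \<eta>
    unfolding s_def using that bdds by (intro cSup_upper) auto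
  \<comment> \<open>The argument \<open>2 * \<eta>\<close> leaves room for intersections, whose
    expansion can be twice as large.\<close>
  have "\<exists>\<eta>>0. \<eta> \<le> (1/2) ^ n \<and> s - (1/2) ^ n < m (2 * \<eta>)" for n :: nat
  proof -
    have "\<exists>y\<in>m ` {0<..}. s - (1/2) ^ n < y"
      unfolding s_def by (intro less_cSupD) (auto intro: exI[of _ 1])
    then obtain \<eta> where \<eta>: "0 < \<eta>" "s - (1/2) ^ n < m \<eta>" by auto
    define \<eta>' where "\<eta>' = min (\<eta> / 2) ((1/2) ^ n)"
    have "0 < \<eta>'" "\<eta>' \<le> (1/2) ^ n" "\<eta>' \<le> \<eta> / 2" using \<eta>(1) by (auto simp: \<eta>'_def)
    then show ?thesis
      using m_anti[of "2 * \<eta>'" \<eta>] \<eta>(2) by (intro exI[of _ \<eta>']) auto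
  qed
  then obtain F :: "nat \<Rightarrow> real" where
    F: "\<And>n. 0 < F n" "\<And>n. F n \<le> (1/2) ^ n" "\<And>n. s - (1/2) ^ n < m (2 * F n)"
    by metis
  \<comment> \<open>The running minimum makes the tolerances decreasing, so that \<open>A j\<close>
    with \<open>j > i\<close> also meets the tolerance of \<open>A i\<close>.\<close>
  define E where "E n = Min (F ` {..n})" for n
  have E_pos: "0 < E n" for n unfolding E_def by (simp add: F(1))
  have E_F: "E n \<le> F n" for n unfolding E_def by simp
  have E_anti: "E j \<le> E i" if "i \<le> j" for i j
    unfolding E_def using that by (intro Min_antimono) auto
  have mE: "s - (1/2) ^ n < m (2 * E n)" for n
    using F(3)[of n] m_anti[of "2 * E n" "2 * F n"] E_pos[of n] E_F[of n] by linarith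
  have "\<exists>A\<in>\<A> (E n). prob A < s + (1/2) ^ n" for n
  proof -
    have "0 < (1/2 :: real) ^ n" by simp
    then have "m (E n) < s + (1/2) ^ n" using m_s[OF E_pos[of n]] by linarith
    then have "\<exists>y\<in>prob ` \<A> (E n). y < s + (1/2) ^ n"
      unfolding m_def using ne[OF E_pos[of n]] by (intro cInf_lessD) auto
    then show ?thesis by blast
  qed
  then obtain A where A: "\<And>n. A n \<in> \<A> (E n)" and A_s: "\<And>n. prob (A n) < s + (1/2) ^ n"
    by metis
  have A_ev: "A n \<in> events" and A_e: "expansion M \<Lambda> (A n) \<le> E n"
    and A_d: "d < prob (A n)" and A_half: "prob (A n) \<le> 1/2" for n
    using A[of n] by (auto simp: \<A>_def)
  have e_Int: "expansion M \<Lambda> (A i \<inter> A j) \<le> 2 * E i" if "i < j" for i j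
    using expansion_Int_le[OF A_ev A_ev, of i j] A_e[of i] A_e[of j] E_anti[of i j] that by simp
  have far: "prob (A i \<inter> A j) \<le> 2 * C * (1/2) ^ i" if "i < j" "prob (A i \<inter> A j) \<le> d" for i j
  proof -
    have "prob (A i \<inter> A j) \<le> C * expansion M \<Lambda> (A i \<inter> A j)"
      using small[OF _ that(2)] A_ev by auto
    also have "\<dots> \<le> C * (2 * (1/2) ^ i)"
      using e_Int[OF that(1)] E_F[of i] F(2)[of i] C by (intro mult_left_mono) auto
    finally show ?thesis by simp
  qed
  \<comment> \<open>The intersection competes in the infimum \<open>m (2 * E i)\<close>, so it has
    measure above \<open>s - (1/2) ^ i\<close>, while the two sets lie below
    \<open>s + (1/2) ^ i\<close> and \<open>s + (1/2) ^ j\<close>. Twice the first bound and once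
    each of the others make up the 4.\<close>
  have near: "prob (sym_diff (A i) (A j)) \<le> 4 * (1/2) ^ i"
    if "i < j" "d < prob (A i \<inter> A j)" for i j
  proof -
    have "prob (A i \<inter> A j) \<le> prob (A i)" using A_ev by (intro finite_measure_mono) auto
    then have "A i \<inter> A j \<in> \<A> (2 * E i)"
      using e_Int[OF that(1)] that(2) A_ev[of i] A_ev[of j] A_half[of i] by (auto simp: \<A>_def)
    then have "s - (1/2) ^ i < prob (A i \<inter> A j)" using m_le mE[of i] by fastforce
    moreover have "(1/2 :: real) ^ j \<le> (1/2) ^ i"
      using that(1) by (intro power_decreasing) auto
    ultimately show ?thesis
      using A_s[of i] A_s[of j] unfolding prob_sym_diff[OF A_ev A_ev] by linarith
  qed
  \<comment> \<open>Colour 1 marks an intersection above \<open>d\<close>. Ramsey's theorem colours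
    unordered pairs, so the order of the two indices is recovered inside the set.\<close>
  define col where
    "col X = (if \<exists>i\<in>X. \<exists>j\<in>X. i < j \<and> d < prob (A i \<inter> A j) then 1 else 0 :: nat)" for X
  have "\<exists>Y t. Y \<subseteq> UNIV \<and> infinite Y \<and> t < (2::nat) \<and>
      (\<forall>x\<in>Y. \<forall>y\<in>Y. x \<noteq> y \<longrightarrow> col {x, y} = t)"
    by (rule Ramsey2) (auto simp: col_def)
  then obtain H t where H: "infinite H" and Ht: "\<forall>i\<in>H. \<forall>j\<in>H. i \<noteq> j \<longrightarrow> col {i, j} = t"
    by (elim exE conjE)
  define h where "h = enumerate H"
  have h_in: "h n \<in> H" and h_ge: "n \<le> h n" for n
    unfolding h_def using H by (auto simp: enumerate_in_set le_enumerate)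
  have h_mono: "h i < h j" if "i < j" for i j
    unfolding h_def using that H by (rule enumerate_mono)
  have col_h: "col {h i, h j} = t" if "i < j" for i j
    using Ht h_in[of i] h_in[of j] h_mono[OF that] by (metis less_irrefl)
  have pow_h: "(1/2 :: real) ^ h i \<le> (1/2) ^ i" for i
    using h_ge[of i] by (intro power_decreasing) auto
  show False
  proof (cases "t = 1")
    case False
    have "prob (A (h i) \<inter> A (h j)) \<le> d" if "i < j" for i j
    proof (rule ccontr)
      assume "\<not> prob (A (h i) \<inter> A (h j)) \<le> d"
      then have "col {h i, h j} = 1"
        using h_mono[OF that] by (auto simp: col_def not_le)
      then show False using col_h[OF that] False by simp
    qed
    then have "prob (A (h i) \<inter> A (h j)) \<le> 2 * C * (1/2) ^ i" if "i < j" for i j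
      using far[OF h_mono[OF that]] that mult_left_mono[OF pow_h[of i], of "2 * C"] C by fastforce
    then show False
      using d A_d A_ev by (intro no_almost_disjoint_sequence[of "\<lambda>n. A (h n)" d "2 * C"])
        (auto intro: less_imp_le)
  next
    case True
    have big: "d < prob (A (h i) \<inter> A (h j))" if "i < j" for i j
    proof -
      have "col {h i, h j} = 1" using col_h[OF that] True by simp
      then show ?thesis
        using h_mono[OF that] by (auto simp: col_def Int_commute split: if_splits)
    qed
    have "prob (sym_diff (A (h n)) (A (h (Suc n)))) \<le> 4 * (1/2) ^ n" for n
      using near[OF h_mono[of n "Suc n"] big[of n "Suc n"]] pow_h[of n] by linarith
    then obtain L where L: "L \<in> events" "(\<lambda>n. prob (sym_diff L (A (h n)))) \<longlonglongrightarrow> 0"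
      using prob_sym_diff_limit[of "\<lambda>n. A (h n)" 4] A_ev by blast
    have "(\<lambda>n. (1/2) ^ n + prob (sym_diff L (A (h n)))) \<longlonglongrightarrow> 0 + 0"
      using L(2) by (intro tendsto_add LIMSEQ_power_zero) auto
    moreover have "expansion M \<Lambda> L \<le> (1/2) ^ n + prob (sym_diff L (A (h n)))" for n
      using expansion_le_sym_diff[OF L(1) A_ev[of "h n"]] A_e[of "h n"] E_F[of "h n"] F(2)[of "h n"]
        pow_h[of n] by linarith
    ultimately have "expansion M \<Lambda> L \<le> 0 + 0"
      by (intro LIMSEQ_le_const) auto
    then have "invariant_set M \<Lambda> L"
      using expansion_nonneg[of L] L(1) by (simp add: invariant_set_def)
    moreover have "\<bar>prob L - prob (A (h n))\<bar> \<le> prob (sym_diff L (A (h n)))" for n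
    proof -
      have "prob (L \<inter> A (h n)) \<le> prob L" "prob (L \<inter> A (h n)) \<le> prob (A (h n))"
        using L(1) A_ev by (auto intro!: finite_measure_mono)
      then show ?thesis by (simp add: prob_sym_diff L(1) A_ev)
    qed
    then have "\<forall>\<^sub>F n in sequentially. norm (prob (A (h n)) - prob L) \<le> prob (sym_diff L (A (h n)))"
      by (simp add: abs_minus_commute)
    then have lim: "(\<lambda>n. prob (A (h n))) \<longlonglongrightarrow> prob L"
      by (rule LIM_zero_cancel[OF Lim_null_comparison[OF _ L(2)]])
    have "d \<le> prob L"
      using A_d by (intro LIMSEQ_le_const[OF lim]) (auto intro: less_imp_le)
    moreover have "prob L \<le> 1/2"
      using A_half by (intro LIMSEQ_le_const2[OF lim]) auto
    ultimately show False using erg d by fastforce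
  qed
qed

end

subsection \<open>From expansion to a spectral gap\<close>

text \<open>Discrete form of the identity that the levels between \<open>v\<close> and
  \<open>u\<close> have length \<open>max 0 (u - v)\<close>; rounding the two ends costs at most one
  level.\<close>

lemma card_levels_between_le:
  fixes u v \<epsilon> :: real
  assumes "0 < \<epsilon>"
  shows "\<epsilon> * card {k \<in> {1..K::nat}. v < k * \<epsilon> \<and> k * \<epsilon> \<le> u} \<le> max 0 (u - v) + \<epsilon>"
proof -
  let ?S = "{k \<in> {1..K::nat}. v < k * \<epsilon> \<and> k * \<epsilon> \<le> u}"
  have "int ` ?S \<subseteq> {\<lfloor>v / \<epsilon>\<rfloor> + 1..\<lfloor>u / \<epsilon>\<rfloor>}"
  proof clarify
    fix k :: nat assume "v < k * \<epsilon>" "k * \<epsilon> \<le> u"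
    then have "v / \<epsilon> < k" "k \<le> u / \<epsilon>" using assms by (simp_all add: field_simps)
    then show "int k \<in> {\<lfloor>v / \<epsilon>\<rfloor> + 1..\<lfloor>u / \<epsilon>\<rfloor>}" by (simp add: le_floor_iff floor_less_iff add1_zle_eq)
  qed
  then have "card (int ` ?S) \<le> card {\<lfloor>v / \<epsilon>\<rfloor> + 1..\<lfloor>u / \<epsilon>\<rfloor>}" by (intro card_mono) auto
  then have "card ?S \<le> nat (\<lfloor>u / \<epsilon>\<rfloor> - \<lfloor>v / \<epsilon>\<rfloor>)" by (simp add: card_image)
  then have "real (card ?S) \<le> max 0 (\<lfloor>u / \<epsilon>\<rfloor> - \<lfloor>v / \<epsilon>\<rfloor>)" by linarith
  also have "\<dots> \<le> max 0 (u / \<epsilon> - v / \<epsilon>) + 1" by linarith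
  finally have "\<epsilon> * card ?S \<le> \<epsilon> * (max 0 (u / \<epsilon> - v / \<epsilon>) + 1)"
    using assms by (intro mult_left_mono) auto
  also have "\<dots> = max 0 (u - v) + \<epsilon>"
    using assms by (auto simp: max_def field_simps)
  finally show ?thesis .
qed

text \<open>The counterpart from below; having only \<open>K\<close> levels caps \<open>u\<close> at
  \<open>K * \<epsilon>\<close>.\<close>

lemma card_levels_below_ge:
  fixes u \<epsilon> :: real
  assumes "0 < \<epsilon>" "0 \<le> u"
  shows "min u (K * \<epsilon>) - \<epsilon> \<le> \<epsilon> * card {k \<in> {1..K::nat}. k * \<epsilon> \<le> u}"
proof -
  let ?S = "{k \<in> {1..K::nat}. k * \<epsilon> \<le> u}"
  have "{1..min K (nat \<lfloor>u / \<epsilon>\<rfloor>)} \<subseteq> ?S"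
  proof
    fix k assume k: "k \<in> {1..min K (nat \<lfloor>u / \<epsilon>\<rfloor>)}"
    then have "int k \<le> \<lfloor>u / \<epsilon>\<rfloor>" by auto
    then have "real k \<le> u / \<epsilon>" by (simp add: le_floor_iff)
    then show "k \<in> ?S" using k assms by (simp add: field_simps)
  qed
  then have "card {1..min K (nat \<lfloor>u / \<epsilon>\<rfloor>)} \<le> card ?S" by (intro card_mono) auto
  then have "min K (nat \<lfloor>u / \<epsilon>\<rfloor>) \<le> card ?S" by simp
  moreover have "u / \<epsilon> - 1 \<le> nat \<lfloor>u / \<epsilon>\<rfloor>" by linarith
  ultimately have "min (u / \<epsilon>) K - 1 \<le> card ?S" by linarith
  then have "\<epsilon> * (min (u / \<epsilon>) K - 1) \<le> \<epsilon> * card ?S" using assms by (intro mult_left_mono) auto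
  moreover have "\<epsilon> * (min (u / \<epsilon>) K - 1) = min u (K * \<epsilon>) - \<epsilon>"
    using assms by (auto simp: min_def field_simps)
  ultimately show ?thesis by simp
qed

text \<open>\<open>m\<close> is the infimum of the levels exceeded with probability at most 1/2.
  Both strict inequalities at \<open>m\<close> define increasing unions of sets at levels
  \<open>m + 1 / Suc n\<close> and \<open>m - 1 / Suc n\<close>, so the bounds pass to the limit,
  even if \<open>f\<close> takes the value \<open>m\<close> with large probability.\<close>

lemma (in prob_space) median_exists:
  fixes f :: "'a \<Rightarrow> real"
  assumes [measurable]: "f \<in> borel_measurable M"
  obtains m where "prob {x \<in> space M. m < f x} \<le> 1/2" "prob {x \<in> space M. f x < m} \<le> 1/2"
proof -
  define S where "S = {t. prob {x \<in> space M. t < f x} \<le> 1/2}"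
  have mono: "prob {x \<in> space M. t < f x} \<le> prob {x \<in> space M. t' < f x}" if "t' \<le> t" for t t'
    using that by (intro finite_measure_mono) auto
  have "(\<lambda>n. prob {x \<in> space M. real n < f x}) \<longlonglongrightarrow> prob (\<Inter>n. {x \<in> space M. real n < f x})"
    by (intro finite_Lim_measure_decseq) (auto simp: decseq_def)
  moreover have "(\<Inter>n. {x \<in> space M. real n < f x}) = {}"
  proof -
    have "\<exists>n. \<not> real n < f x" for x using reals_Archimedean2[of "f x"] less_asym by blast
    then show ?thesis by auto
  qed
  ultimately have "\<forall>\<^sub>F n in sequentially. prob {x \<in> space M. real n < f x} < 1/2"
    by (intro order_tendstoD(2)[where y = 0]) auto
  then obtain n where "prob {x \<in> space M. real n < f x} < 1/2"
    by (auto simp: eventually_sequentially)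
  then have S_ne: "S \<noteq> {}" unfolding S_def by (auto intro: exI[of _ "real n"])
  have "(\<lambda>n. prob {x \<in> space M. - real n < f x}) \<longlonglongrightarrow> prob (\<Union>n. {x \<in> space M. - real n < f x})"
    by (intro finite_Lim_measure_incseq) (auto simp: incseq_def)
  moreover have "(\<Union>n. {x \<in> space M. - real n < f x}) = space M"
  proof -
    have "\<exists>n. - real n < f x" for x using reals_Archimedean2[of "- f x"] by (auto simp: minus_less_iff)
    then show ?thesis by auto
  qed
  ultimately have "\<forall>\<^sub>F n in sequentially. 1/2 < prob {x \<in> space M. - real n < f x}"
    by (intro order_tendstoD(1)[where y = 1]) (auto simp: prob_space)
  then obtain n' where n': "1/2 < prob {x \<in> space M. - real n' < f x}"
    by (auto simp: eventually_sequentially)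
  have S_bdd: "bdd_below S"
  proof (rule bdd_belowI)
    fix t assume "t \<in> S"
    then show "- real n' \<le> t" using mono[of t "- real n'"] n' unfolding S_def by fastforce
  qed
  define m where "m = Inf S"
  have above: "prob {x \<in> space M. t < f x} \<le> 1/2" if t: "m < t" for t
  proof -
    obtain t' where "t' \<in> S" "t' < t" using cInf_lessD[OF S_ne] t unfolding m_def by blast
    then show ?thesis using mono[of t' t] by (simp add: S_def)
  qed
  have "(\<lambda>n. prob {x \<in> space M. m + 1 / Suc n < f x}) \<longlonglongrightarrow> prob (\<Union>n. {x \<in> space M. m + 1 / Suc n < f x})"
  proof (intro finite_Lim_measure_incseq)
    have "m + 1 / Suc j \<le> m + 1 / Suc i" if "i \<le> j" for i j using that by (simp add: frac_le)
    then show "incseq (\<lambda>n. {x \<in> space M. m + 1 / Suc n < f x})"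
      by (fastforce simp: incseq_def)
  qed auto
  moreover have "(\<Union>n. {x \<in> space M. m + 1 / Suc n < f x}) = {x \<in> space M. m < f x}"
  proof -
    have "(\<exists>n. m + 1 / Suc n < f x) \<longleftrightarrow> m < f x" for x
    proof
      assume "m < f x"
      then obtain n where "inverse (Suc n) < f x - m" using reals_Archimedean[of "f x - m"] by auto
      then show "\<exists>n. m + 1 / Suc n < f x" by (auto simp: inverse_eq_divide intro!: exI[of _ n])
    next
      assume "\<exists>n. m + 1 / Suc n < f x"
      then obtain n where "m + 1 / Suc n < f x" by blast
      moreover have "0 < 1 / real (Suc n)" by simp
      ultimately show "m < f x" by linarith
    qed
    then show ?thesis by auto
  qed
  ultimately have 1: "prob {x \<in> space M. m < f x} \<le> 1/2"
    using above by (intro LIMSEQ_le_const2[where X = "\<lambda>n. prob {x \<in> space M. m + 1 / Suc n < f x}"]) auto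
  have below: "prob {x \<in> space M. f x \<le> t} \<le> 1/2" if "t < m" for t
  proof -
    have "t \<notin> S" using cInf_lower[OF _ S_bdd, of t] that by (auto simp: m_def)
    moreover have "prob {x \<in> space M. f x \<le> t} = 1 - prob {x \<in> space M. t < f x}"
      by (subst prob_compl[symmetric]) (auto intro!: arg_cong[where f = prob])
    ultimately show ?thesis by (simp add: S_def)
  qed
  have "(\<lambda>n. prob {x \<in> space M. f x \<le> m - 1 / Suc n}) \<longlonglongrightarrow> prob (\<Union>n. {x \<in> space M. f x \<le> m - 1 / Suc n})"
  proof (intro finite_Lim_measure_incseq)
    have "m - 1 / Suc i \<le> m - 1 / Suc j" if "i \<le> j" for i j using that by (simp add: frac_le)
    then show "incseq (\<lambda>n. {x \<in> space M. f x \<le> m - 1 / Suc n})"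
      by (fastforce simp: incseq_def)
  qed auto
  moreover have "(\<Union>n. {x \<in> space M. f x \<le> m - 1 / Suc n}) = {x \<in> space M. f x < m}"
  proof -
    have "(\<exists>n. f x \<le> m - 1 / Suc n) \<longleftrightarrow> f x < m" for x
    proof
      assume "f x < m"
      then obtain n where "inverse (Suc n) < m - f x" using reals_Archimedean[of "m - f x"] by auto
      then show "\<exists>n. f x \<le> m - 1 / Suc n" by (auto simp: inverse_eq_divide intro!: exI[of _ n])
    next
      assume "\<exists>n. f x \<le> m - 1 / Suc n"
      then obtain n where "f x \<le> m - 1 / Suc n" by blast
      moreover have "0 < 1 / real (Suc n)" by simp
      ultimately show "f x < m" by linarith
    qed
    then show ?thesis by auto
  qed
  ultimately have "prob {x \<in> space M. f x < m} \<le> 1/2"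
    using below by (intro LIMSEQ_le_const2[where X = "\<lambda>n. prob {x \<in> space M. f x \<le> m - 1 / Suc n}"]) auto
  with 1 show ?thesis by (rule that)
qed

lemma (in prob_space)
  fixes \<epsilon> :: real
  assumes "\<And>k. C k \<in> events"
  shows integrable_sum_indicator: "integrable M (\<lambda>x. \<Sum>k\<in>I. \<epsilon> * indicator (C k) x)"
    and expectation_sum_indicator:
      "(\<integral>x. (\<Sum>k\<in>I. \<epsilon> * indicator (C k) x) \<partial>M) = (\<Sum>k\<in>I. \<epsilon> * prob (C k))"
proof -
  have ind: "integrable M (indicat_real (C k))" "expectation (indicat_real (C k)) = prob (C k)" for k
    using assms by (auto intro!: integrable_const_bound[where B = 1])
  have int: "integrable M (\<lambda>x. \<epsilon> * indicator (C k) x)" for k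
    using ind(1) by (rule integrable_mult_right)
  show "integrable M (\<lambda>x. \<Sum>k\<in>I. \<epsilon> * indicator (C k) x)"
    using int by (rule Bochner_Integration.integrable_sum)
  have "(\<integral>x. (\<Sum>k\<in>I. \<epsilon> * indicator (C k) x) \<partial>M) = (\<Sum>k\<in>I. \<integral>x. \<epsilon> * indicator (C k) x \<partial>M)"
    using int by (rule Bochner_Integration.integral_sum)
  then show "(\<integral>x. (\<Sum>k\<in>I. \<epsilon> * indicator (C k) x) \<partial>M) = (\<Sum>k\<in>I. \<epsilon> * prob (C k))"
    by (simp only: integral_mult_right_zero ind(2))
qed

section \<open>Dirichlet form and Cheeger's inequality\<close>

context aut_law
begin

text \<open>A translate has the same norm as \<open>f\<close>, so the defect of the quadratic form
  is half a Dirichlet form, for each automorphism by itself.\<close>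

lemma integral_square_increment:
  assumes a: "a \<in> space \<Lambda>" and f: "f \<in> L2 M"
  shows "(\<integral>x. (f (rep a x) - f x)\<^sup>2 \<partial>M) = 2 * (inner_L2 M f f - inner_L2 M (\<lambda>x. f (rep a x)) f)"
  using inner_L2_diff_self[OF L2_rep[OF a f] f] inner_L2_iso_iso[OF rep_iso[OF a] f] by simp

lemma integrable_square_increment:
  assumes a: "a \<in> space \<Lambda>" and f: "f \<in> L2 M"
  shows "integrable M (\<lambda>x. (f (rep a x) - f x)\<^sup>2)"
  using L2_diff[OF L2_rep[OF a f] f] by (rule L2_integrable_square)

lemma integral_corr_defect:
  assumes f: "f \<in> L2 M"
  shows "(\<integral>a. inner_L2 M f f - inner_L2 M (\<lambda>x. f (rep a x)) f \<partial>\<Lambda>) = inner_L2 M f f - corr f"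
  using integrable_inner_rep[OF f f] by (simp add: corr_def law.prob_space)

lemma integrable_corr_defect:
  assumes f: "f \<in> L2 M"
  shows "integrable \<Lambda> (\<lambda>a. inner_L2 M f f - inner_L2 M (\<lambda>x. f (rep a x)) f)"
  using integrable_inner_rep[OF f f] by simp

text \<open>A coarea inequality over the discrete levels \<open>k \<epsilon>\<close>: joint measurability in the level and the
  automorphism is not needed, at the price of an error \<open>\<epsilon>\<close>.\<close>

lemma prob_levels_cross_le:
  fixes h :: "'a \<Rightarrow> real" and K :: nat
  assumes a: "a \<in> space \<Lambda>" and h: "h \<in> L2 M" and s: "0 < s" and \<epsilon>: "0 < \<epsilon>"
  defines "A k \<equiv> {x \<in> space M. real k * \<epsilon> \<le> (h x)\<^sup>2}"
  shows "(\<Sum>k=1..K. \<epsilon> * prob (rep a ` A k - A k))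
    \<le> (1 / s) * (inner_L2 M h h - inner_L2 M (\<lambda>x. h (rep a x)) h) + 2 * s * inner_L2 M h h + \<epsilon>"
proof -
  let ?t = "rep a"
  note t = rep_iso[OF a]
  note [measurable] = iso_measurable[OF t] L2_measurable[OF h]
  \<comment> \<open>By conservation of mass the crossings are counted as points that enter the level
    set: at a point \<open>x\<close> these are the levels above \<open>(h x)\<^sup>2\<close> and up
    to the square of the new value.\<close>
  define C where "C k = {x \<in> space M. x \<notin> A k \<and> ?t x \<in> A k}" for k
  have A_ev [measurable]: "A k \<in> events" for k unfolding A_def by measurable
  have C_ev: "C k \<in> events" for k unfolding C_def by measurable
  have pw: "(\<Sum>k=1..K. \<epsilon> * indicator (C k) x)
      \<le> (1 / (2 * s)) * (h (?t x) - h x)\<^sup>2 + s * ((h (?t x))\<^sup>2 + (h x)\<^sup>2) + \<epsilon>"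
    if x: "x \<in> space M" for x
  proof -
    let ?u = "h (?t x)" and ?v = "h x"
    have "(\<Sum>k=1..K. \<epsilon> * indicator (C k) x)
        = (\<Sum>k=1..K. \<epsilon> * (if (?v)\<^sup>2 < k * \<epsilon> \<and> k * \<epsilon> \<le> (?u)\<^sup>2 then 1 else 0))"
      using x measurable_space[OF iso_measurable[OF t] x]
      by (intro sum.cong refl) (auto simp: C_def A_def not_le indicator_def)
    also have "\<dots> = \<epsilon> * card {k \<in> {1..K}. (?v)\<^sup>2 < k * \<epsilon> \<and> k * \<epsilon> \<le> (?u)\<^sup>2}"
      by (subst sum_distrib_left[symmetric]) (simp add: sum.If_cases Int_def)
    also have "\<dots> \<le> max 0 ((?u)\<^sup>2 - (?v)\<^sup>2) + \<epsilon>"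
      by (rule card_levels_between_le[OF \<epsilon>])
    \<comment> \<open>A weighted arithmetic-geometric mean inequality for
      \<open>(u - v) * (u + v)\<close>. The parameter \<open>s\<close> takes the place of the square
      roots in the usual Cauchy--Schwarz step and is fixed only after integration.\<close>
    also have "max 0 ((?u)\<^sup>2 - (?v)\<^sup>2) \<le> (1 / (2 * s)) * (?u - ?v)\<^sup>2 + s * ((?u)\<^sup>2 + (?v)\<^sup>2)"
    proof -
      have "0 \<le> (1 / (2 * s)) * ((?u - ?v) - s * (?u + ?v))\<^sup>2 + (s / 2) * (?u - ?v)\<^sup>2"
        using s by simp
      also have "\<dots> = (1 / (2 * s)) * (?u - ?v)\<^sup>2 + s * ((?u)\<^sup>2 + (?v)\<^sup>2) - ((?u)\<^sup>2 - (?v)\<^sup>2)"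
        using s by (simp add: field_simps power2_eq_square)
      finally show ?thesis using s by simp
    qed
    finally show ?thesis by simp
  qed
  have "(\<Sum>k=1..K. \<epsilon> * prob (?t ` A k - A k)) = (\<Sum>k=1..K. \<epsilon> * prob (C k))"
    by (simp add: iso_measure_leave(2)[OF t A_ev] C_def)
  also have "\<dots> = (\<integral>x. (\<Sum>k=1..K. \<epsilon> * indicator (C k) x) \<partial>M)"
    by (rule expectation_sum_indicator[OF C_ev, symmetric])
  also have "\<dots> \<le> (\<integral>x. (1 / (2 * s)) * (h (?t x) - h x)\<^sup>2 + s * ((h (?t x))\<^sup>2 + (h x)\<^sup>2) + \<epsilon> \<partial>M)"
    using L2_integrable_square[OF h] L2_integrable_square[OF L2_rep[OF a h]]
      integrable_square_increment[OF a h] pw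
    by (intro integral_mono integrable_sum_indicator C_ev) auto
  also have "\<dots> = (1 / (2 * s)) * (\<integral>x. (h (?t x) - h x)\<^sup>2 \<partial>M)
      + s * (inner_L2 M (\<lambda>x. h (?t x)) (\<lambda>x. h (?t x)) + inner_L2 M h h) + \<epsilon>"
    using L2_integrable_square[OF h] L2_integrable_square[OF L2_rep[OF a h]]
      integrable_square_increment[OF a h]
    by (simp add: inner_L2_def power2_eq_square[symmetric] prob_space)
  also have "\<dots> = (1 / s) * (inner_L2 M h h - inner_L2 M (\<lambda>x. h (?t x)) h) + 2 * s * inner_L2 M h h + \<epsilon>"
    unfolding integral_square_increment[OF a h] inner_L2_iso_iso[OF t h]
    using s by (simp add: field_simps)
  finally show ?thesis .
qed

text \<open>Superlevel sets of the square of \<open>h\<close> at positive levels lie in the support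
  of \<open>h\<close>, hence expand. Summing over the levels turns their measures into the squared
  norm of \<open>h\<close>, and the crossings into the defect of the quadratic form.\<close>

lemma small_support_corr_le:
  fixes h :: "'a \<Rightarrow> real"
  assumes \<eta>: "0 < \<eta>" "\<And>A. A \<in> events \<Longrightarrow> prob A \<le> 1/2 \<Longrightarrow> \<eta> * prob A \<le> expansion M \<Lambda> A"
    and h: "h \<in> L2 M" and supp: "prob {x \<in> space M. h x \<noteq> 0} \<le> 1/2"
  shows "\<eta>\<^sup>2 / 8 * inner_L2 M h h \<le> inner_L2 M h h - corr h"
proof -
  note [measurable] = L2_measurable[OF h]
  let ?I = "inner_L2 M h h"
  \<comment> \<open>With this choice \<open>2 * s\<close> is \<open>\<eta> / 2\<close>, so that half
    of the left side is absorbed; the factor \<open>1 / s\<close> then leads to the constant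
    \<open>\<eta>\<^sup>2 / 8\<close>.\<close>
  define s where "s = \<eta> / 4"
  have s: "0 < s" using \<eta> by (simp add: s_def)
  define R where "R = (1 / s) * (?I - corr h) + 2 * s * ?I"
  \<comment> \<open>Finitely many levels reach only up to \<open>K * \<epsilon>\<close>. Afterwards
    \<open>K\<close> tends to infinity for fixed \<open>\<epsilon>\<close>, and then
    \<open>\<epsilon>\<close> to 0.\<close>
  have trunc: "\<eta> * ((\<integral>x. min ((h x)\<^sup>2) (real K * \<epsilon>) \<partial>M) - \<epsilon>) \<le> R + \<epsilon>"
    if \<epsilon>: "0 < \<epsilon>" for \<epsilon> and K :: nat
  proof -
    define A where "A k = {x \<in> space M. real k * \<epsilon> \<le> (h x)\<^sup>2}" for k
    have A_ev [measurable]: "A k \<in> events" for k unfolding A_def by measurable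
    \<comment> \<open>The levels start at 1: level 0 is the whole space, which is too large and does
      not expand.\<close>
    have A_exp: "\<eta> * prob (A k) \<le> expansion M \<Lambda> (A k)" if "1 \<le> k" for k
    proof (rule \<eta>(2)[OF A_ev])
      have "0 < real k * \<epsilon>" using that \<epsilon> by simp
      then have "prob (A k) \<le> prob {x \<in> space M. h x \<noteq> 0}"
        unfolding A_def by (intro finite_measure_mono) auto
      then show "prob (A k) \<le> 1/2" using supp by simp
    qed
    have pw: "min ((h x)\<^sup>2) (real K * \<epsilon>) - \<epsilon> \<le> (\<Sum>k=1..K. \<epsilon> * indicator (A k) x)"
      if x: "x \<in> space M" for x
    proof -
      have "(\<Sum>k=1..K. \<epsilon> * indicator (A k) x) = (\<Sum>k=1..K. \<epsilon> * (if k * \<epsilon> \<le> (h x)\<^sup>2 then 1 else 0))"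
        using x by (intro sum.cong refl) (auto simp: A_def indicator_def)
      also have "\<dots> = \<epsilon> * card {k \<in> {1..K}. k * \<epsilon> \<le> (h x)\<^sup>2}"
        by (subst sum_distrib_left[symmetric]) (simp add: sum.If_cases Int_def)
      finally show ?thesis
        using card_levels_below_ge[OF \<epsilon>, of "(h x)\<^sup>2" K] by (simp only: zero_le_power2)
    qed
    have min_int: "integrable M (\<lambda>x. min ((h x)\<^sup>2) (real K * \<epsilon>))"
      using \<epsilon> by (intro integrable_const_bound[where B = "real K * \<epsilon>"]) auto
    have "(\<integral>x. min ((h x)\<^sup>2) (real K * \<epsilon>) \<partial>M) - \<epsilon> = (\<integral>x. min ((h x)\<^sup>2) (real K * \<epsilon>) - \<epsilon> \<partial>M)"
      using min_int by (simp add: prob_space)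
    also have "\<dots> \<le> (\<integral>x. (\<Sum>k=1..K. \<epsilon> * indicator (A k) x) \<partial>M)"
      using min_int pw by (intro integral_mono integrable_sum_indicator A_ev) auto
    also have "\<dots> = (\<Sum>k=1..K. \<epsilon> * prob (A k))" by (rule expectation_sum_indicator[OF A_ev])
    finally have "\<eta> * ((\<integral>x. min ((h x)\<^sup>2) (real K * \<epsilon>) \<partial>M) - \<epsilon>) \<le> \<eta> * (\<Sum>k=1..K. \<epsilon> * prob (A k))"
      using \<eta>(1) by (intro mult_left_mono) auto
    also have "\<dots> = (\<Sum>k=1..K. \<epsilon> * (\<eta> * prob (A k)))" by (simp add: sum_distrib_left mult.left_commute)
    also have "\<dots> \<le> (\<Sum>k=1..K. \<epsilon> * expansion M \<Lambda> (A k))"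
      using A_exp \<epsilon> by (intro sum_mono mult_left_mono) auto
    also have "\<dots> = (\<integral>a. (\<Sum>k=1..K. \<epsilon> * prob (rep a ` A k - A k)) \<partial>\<Lambda>)"
      by (simp add: expansion_def integrable_prob_leave A_ev)
    also have "\<dots> \<le> (\<integral>a. (1 / s) * (?I - inner_L2 M (\<lambda>x. h (rep a x)) h) + 2 * s * ?I + \<epsilon> \<partial>\<Lambda>)"
    proof (intro integral_mono)
      show "integrable \<Lambda> (\<lambda>a. (1 / s) * (?I - inner_L2 M (\<lambda>x. h (rep a x)) h) + 2 * s * ?I + \<epsilon>)"
        using integrable_corr_defect[OF h] by (intro Bochner_Integration.integrable_add integrable_mult_right) auto
    qed (use prob_levels_cross_le[OF _ h s \<epsilon>] in
        \<open>auto simp: A_def intro!: Bochner_Integration.integrable_sum integrable_mult_right integrable_prob_leave\<close>)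
    also have "\<dots> = R + \<epsilon>"
    proof -
      have "integrable \<Lambda> (\<lambda>a. (1 / s) * (?I - inner_L2 M (\<lambda>x. h (rep a x)) h))"
        using integrable_corr_defect[OF h] by (rule integrable_mult_right)
      then show ?thesis
        using integral_corr_defect[OF h] integrable_corr_defect[OF h]
        by (simp add: R_def law.prob_space del: Bochner_Integration.integral_diff)
    qed
    finally show ?thesis .
  qed
  have lim: "\<eta> * (?I - \<epsilon>) \<le> R + \<epsilon>" if \<epsilon>: "0 < \<epsilon>" for \<epsilon>
  proof -
    have "(\<lambda>K. \<integral>x. min ((h x)\<^sup>2) (real K * \<epsilon>) \<partial>M) \<longlonglongrightarrow> (\<integral>x. (h x)\<^sup>2 \<partial>M)"
    proof (intro integral_dominated_convergence[where w = "\<lambda>x. (h x)\<^sup>2"])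
      show "AE x in M. (\<lambda>K. min ((h x)\<^sup>2) (real K * \<epsilon>)) \<longlonglongrightarrow> (h x)\<^sup>2"
      proof (rule AE_I2)
        fix x
        obtain K0 :: nat where K0: "(h x)\<^sup>2 < K0 * \<epsilon>" using reals_Archimedean3[OF \<epsilon>] by blast
        have "min ((h x)\<^sup>2) (real K * \<epsilon>) = (h x)\<^sup>2" if "K0 \<le> K" for K
        proof -
          have "real K0 * \<epsilon> \<le> real K * \<epsilon>" using that \<epsilon> by simp
          then show ?thesis using K0 by simp
        qed
        then show "(\<lambda>K. min ((h x)\<^sup>2) (real K * \<epsilon>)) \<longlonglongrightarrow> (h x)\<^sup>2"
          by (intro tendsto_eventually) (auto simp: eventually_sequentially)
      qed
    qed (use L2_integrable_square[OF h] \<epsilon> in auto)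
    then have "(\<lambda>K. \<eta> * ((\<integral>x. min ((h x)\<^sup>2) (real K * \<epsilon>) \<partial>M) - \<epsilon>)) \<longlonglongrightarrow> \<eta> * (?I - \<epsilon>)"
      unfolding inner_L2_def power2_eq_square[symmetric] by (intro tendsto_intros)
    then show ?thesis using trunc[OF \<epsilon>] by (intro LIMSEQ_le_const2) auto
  qed
  have "\<eta> * ?I \<le> R"
  proof (rule field_le_epsilon)
    fix e :: real assume "0 < e"
    define \<epsilon> where "\<epsilon> = e / (1 + \<eta>)"
    have "0 < \<epsilon>" "(1 + \<eta>) * \<epsilon> = e" using \<open>0 < e\<close> \<eta>(1) by (simp_all add: \<epsilon>_def)
    then show "\<eta> * ?I \<le> R + e" using lim[of \<epsilon>] by (simp add: algebra_simps)
  qed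
  moreover have "1 / s = 4 / \<eta>" "2 * s * ?I = \<eta> * ?I / 2" by (simp_all add: s_def)
  then have "R = 4 / \<eta> * (?I - corr h) + \<eta> * ?I / 2"
    unfolding R_def by (simp only:)
  ultimately have "\<eta> * ?I / 2 \<le> 4 / \<eta> * (?I - corr h)" by linarith
  then have "\<eta> / 4 * (\<eta> * ?I / 2) \<le> \<eta> / 4 * (4 / \<eta> * (?I - corr h))"
    using \<eta>(1) by (intro mult_left_mono) auto
  then show ?thesis using \<eta>(1) by (simp add: power2_eq_square)
qed

text \<open>Cheeger's inequality; the median splits \<open>f\<close> into two parts of small support.\<close>

lemma expansion_imp_rho_plus_less_1:
  assumes \<eta>: "0 < \<eta>" "\<And>A. A \<in> events \<Longrightarrow> prob A \<le> 1/2 \<Longrightarrow> \<eta> * prob A \<le> expansion M \<Lambda> A"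
  shows "rho_plus M \<Lambda> < 1"
proof -
  \<comment> \<open>The minimum with 1 secures \<open>-1 \<le> 1 - \<delta>\<close>, as
    \<open>rho_plus_le\<close> demands.\<close>
  define \<delta> where "\<delta> = min 1 (\<eta>\<^sup>2 / 8)"
  have \<delta>: "0 < \<delta>" "\<delta> \<le> 1" "\<delta> \<le> \<eta>\<^sup>2 / 8" using \<eta>(1) by (simp_all add: \<delta>_def)
  have "corr f \<le> (1 - \<delta>) * inner_L2 M f f" if f: "f \<in> L2_zero M" for f
  proof -
    have f2: "f \<in> L2 M" and f0: "expectation f = 0" using f by (auto simp: L2_zero_def)
    note [measurable] = L2_measurable[OF f2]
    obtain m where m: "prob {x \<in> space M. m < f x} \<le> 1/2" "prob {x \<in> space M. f x < m} \<le> 1/2"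
      using median_exists[of f] by auto
    have const: "(\<lambda>x. c) \<in> L2 M" for c :: real by (simp add: L2_def)
    define p where "p x = max 0 (f x - m)" for x
    define q where "q x = max 0 (- (f x - m))" for x
    have p2: "p \<in> L2 M" and q2: "q \<in> L2 M"
      unfolding p_def q_def
      by (rule L2_pos_part[OF L2_diff[OF f2 const]] L2_neg_part[OF L2_diff[OF f2 const]])+
    have "{x \<in> space M. p x \<noteq> 0} = {x \<in> space M. m < f x}"
      and "{x \<in> space M. q x \<noteq> 0} = {x \<in> space M. f x < m}" by (auto simp: p_def q_def max_def)
    then have gap: "\<eta>\<^sup>2 / 8 * inner_L2 M p p \<le> inner_L2 M p p - corr p"
      "\<eta>\<^sup>2 / 8 * inner_L2 M q q \<le> inner_L2 M q q - corr q"
      using small_support_corr_le[OF \<eta> p2] small_support_corr_le[OF \<eta> q2] m by simp_all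
    \<comment> \<open>Both sides are the squared norm of \<open>f - m\<close>, and the mixed term
      vanishes because \<open>f\<close> has mean zero. Subtracting the median therefore does not
      decrease the norm.\<close>
    have "inner_L2 M f f + m\<^sup>2 = inner_L2 M p p + inner_L2 M q q"
    proof -
      have f1: "integrable M f" using L2_mult_integrable[OF f2 const[of 1]] by simp
      have "inner_L2 M p p + inner_L2 M q q = (\<integral>x. p x * p x + q x * q x \<partial>M)"
        unfolding inner_L2_def using L2_mult_integrable[OF p2 p2] L2_mult_integrable[OF q2 q2] by simp
      also have "\<dots> = (\<integral>x. f x * f x - 2 * m * f x + m\<^sup>2 \<partial>M)"
        by (intro Bochner_Integration.integral_cong)
          (auto simp: p_def q_def max_def algebra_simps power2_eq_square)
      also have "\<dots> = inner_L2 M f f + m\<^sup>2"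
        unfolding inner_L2_def using L2_mult_integrable[OF f2 f2] f1 f0 by (simp add: prob_space)
      finally show ?thesis by simp
    qed
    then have norm: "inner_L2 M f f \<le> inner_L2 M p p + inner_L2 M q q"
      using zero_le_power2[of m] by linarith
    have split: "(inner_L2 M p p - inner_L2 M (\<lambda>x. p (rep a x)) p)
        + (inner_L2 M q q - inner_L2 M (\<lambda>x. q (rep a x)) q)
        \<le> inner_L2 M f f - inner_L2 M (\<lambda>x. f (rep a x)) f" if a: "a \<in> space \<Lambda>" for a
    proof -
      \<comment> \<open>For equal signs both sides agree; for opposite signs the right side exceeds
        \<open>u\<^sup>2 + v\<^sup>2\<close> by \<open>- 2 * u * v\<close>, which is
        nonnegative.\<close>
      have pw: "(max 0 u - max 0 v)\<^sup>2 + (max 0 (- u) - max 0 (- v))\<^sup>2 \<le> (u - v)\<^sup>2" for u v :: real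
      proof (cases "0 \<le> u"; cases "0 \<le> v")
        assume "0 \<le> u" "\<not> 0 \<le> v"
        then show ?thesis using mult_nonneg_nonpos[of u v]
          by (simp add: max_def power2_eq_square algebra_simps)
      next
        assume "\<not> 0 \<le> u" "0 \<le> v"
        then show ?thesis using mult_nonneg_nonpos[of v u]
          by (simp add: max_def power2_eq_square algebra_simps)
      qed (auto simp: max_def power2_eq_square algebra_simps)
      have "(p (rep a x) - p x)\<^sup>2 + (q (rep a x) - q x)\<^sup>2 \<le> (f (rep a x) - f x)\<^sup>2" for x
        using pw[of "f (rep a x) - m" "f x - m"] by (simp add: p_def q_def)
      then have "(\<integral>x. (p (rep a x) - p x)\<^sup>2 + (q (rep a x) - q x)\<^sup>2 \<partial>M)
          \<le> (\<integral>x. (f (rep a x) - f x)\<^sup>2 \<partial>M)"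
        using p2 q2 f2 a
        by (intro integral_mono Bochner_Integration.integrable_add integrable_square_increment)
      moreover have "(\<integral>x. (p (rep a x) - p x)\<^sup>2 + (q (rep a x) - q x)\<^sup>2 \<partial>M)
          = (\<integral>x. (p (rep a x) - p x)\<^sup>2 \<partial>M) + (\<integral>x. (q (rep a x) - q x)\<^sup>2 \<partial>M)"
        using p2 q2 a by (intro Bochner_Integration.integral_add integrable_square_increment)
      ultimately show ?thesis
        using p2 q2 f2 a by (simp add: integral_square_increment)
    qed
    have "(inner_L2 M p p - corr p) + (inner_L2 M q q - corr q) \<le> inner_L2 M f f - corr f"
      unfolding integral_corr_defect[OF f2, symmetric] integral_corr_defect[OF p2, symmetric]
        integral_corr_defect[OF q2, symmetric]
      using p2 q2 f2 split
      by (subst Bochner_Integration.integral_add[symmetric])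
        (auto intro!: integral_mono integrable_corr_defect Bochner_Integration.integrable_add
          simp del: Bochner_Integration.integral_diff)
    moreover have "\<delta> * inner_L2 M f f \<le> \<eta>\<^sup>2 / 8 * (inner_L2 M p p + inner_L2 M q q)"
      using \<delta> norm by (intro mult_mono) (auto simp: inner_L2_self_nonneg)
    ultimately have "\<delta> * inner_L2 M f f \<le> inner_L2 M f f - corr f"
      using gap by (simp add: distrib_left)
    then show ?thesis by (simp add: algebra_simps)
  qed
  then have "rho_plus M \<Lambda> \<le> 1 - \<delta>" using \<delta> by (intro rho_plus_le) auto
  then show ?thesis using \<delta> by simp
qed

end

text \<open>Ergodicity of \<open>Y\<close> becomes a zero-one law on the normalized piece. A subset
  of normalized measure at most \<open>d\<close> also has measure at most \<open>d\<close> in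
  \<open>M\<close>, so \<open>small\<close> carries over with the same \<open>d\<close> and
  \<open>C\<close>.\<close>

lemma (in aut_law) ergodic_spectral_gap:
  assumes erg: "ergodic_set M \<Lambda> Y" and pos: "0 < prob Y"
    and d: "0 < d" and C: "0 \<le> C"
    and small: "\<And>A. A \<in> events \<Longrightarrow> prob A \<le> d \<Longrightarrow> prob A \<le> C * expansion M \<Lambda> A"
  shows "spectral_gap_on M \<Lambda> Y"
proof -
  let ?N = "normalized_restriction M Y" and ?R = "restrict_law M Y \<Lambda>"
  have inv: "invariant_set M \<Lambda> Y" using erg by (simp add: ergodic_set_def)
  then have Y: "Y \<in> events" by (simp add: invariant_set_def)
  interpret R: aut_law ?N ?R by (rule aut_law_restriction[OF inv pos])
  have sub: "A \<in> events" "A \<subseteq> Y" "measure ?N A = prob A / prob Y"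
    "expansion ?N ?R A = expansion M \<Lambda> A / prob Y" if "A \<in> sets ?N" for A
    using that Y expansion_restriction[OF inv pos that]
    by (auto simp: sets_normalized_restriction measure_normalized_restriction)
  have "\<exists>\<eta>>0. \<forall>A\<in>sets ?N. measure ?N A \<le> 1/2 \<longrightarrow> \<eta> * measure ?N A \<le> expansion ?N ?R A"
  proof (rule R.ergodic_small_set_expansion[OF _ d C])
    fix Z assume Z: "invariant_set ?N ?R Z"
    then have "Z \<in> sets ?N" "expansion ?N ?R Z = 0" by (simp_all add: invariant_set_def)
    then have "invariant_set M \<Lambda> Z" "Z \<subseteq> Y"
      using sub pos by (auto simp: invariant_set_def)
    then have "prob Z = 0 \<or> prob (Y - Z) = 0" "prob (Y - Z) = prob Y - prob Z"
      using erg Y by (auto simp: ergodic_set_def invariant_set_def finite_measure_Diff)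
    then show "measure ?N Z = 0 \<or> measure ?N Z = 1"
      using sub(3)[OF \<open>Z \<in> sets ?N\<close>] pos by auto
  next
    fix A assume A: "A \<in> sets ?N" "measure ?N A \<le> d"
    have "prob A = measure ?N A * prob Y" using sub(3)[OF A(1)] pos by simp
    also have "\<dots> \<le> measure ?N A * 1" by (intro mult_left_mono) auto
    finally have "prob A \<le> C * expansion M \<Lambda> A" using small[OF sub(1)[OF A(1)]] A(2) by simp
    then show "measure ?N A \<le> C * expansion ?N ?R A"
      using pos by (simp add: sub(3,4)[OF A(1)] divide_right_mono)
  qed
  then obtain \<eta> where "0 < \<eta>" "\<And>A. A \<in> sets ?N \<Longrightarrow> measure ?N A \<le> 1/2 \<Longrightarrow>
      \<eta> * measure ?N A \<le> expansion ?N ?R A"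
    by blast
  then show ?thesis
    unfolding spectral_gap_on_def by (rule R.expansion_imp_rho_plus_less_1)
qed

theorem lemma2:
  fixes M :: "'a measure"
    and \<Lambda> \<Lambda>\<^sub>1 \<Lambda>\<^sub>2 :: "('a \<Rightarrow> 'a) set measure"
    and \<kappa> \<rho> :: real
  assumes "standard_borel_prob_space M"
    and "borel_prob_on_Aut M \<Lambda>"
    and "borel_prob_on_Aut M \<Lambda>\<^sub>1"
    and "borel_prob_on_Aut M \<Lambda>\<^sub>2"
    and "\<rho> = rho_plus M \<Lambda>"
    and "0 < \<kappa>" and "\<kappa> \<le> 1" and "\<rho> < \<kappa>"
    and "\<forall>A \<in> sets (Aut_borel M). measure \<Lambda> A = \<kappa> * measure \<Lambda>\<^sub>1 A + (1 - \<kappa>) * measure \<Lambda>\<^sub>2 A"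
  shows "(\<forall>Y. invariant_set M \<Lambda>\<^sub>1 Y \<and> measure M Y > 0 \<longrightarrow>
             measure M Y \<ge> (\<kappa> - \<rho>) / (1 - \<rho>)) \<and>
         (\<forall>Y \<in> sets M. 0 < measure M Y \<and> measure M Y \<le> 1/2 * ((\<kappa> - \<rho>) / (1 - \<rho>)) \<longrightarrow>
             expansion M \<Lambda>\<^sub>1 Y / measure M Y \<ge> 1/2 * ((\<kappa> - \<rho>) / \<kappa>)) \<and>
         (\<exists>(n::nat) (X :: nat \<Rightarrow> 'a set).
             real n \<le> (1 - \<rho>) / (\<kappa> - \<rho>) \<and>
             (\<forall>i \<in> {1..n}. X i \<in> sets M \<and> measure M (X i) > 0 \<and>
                ergodic_set M \<Lambda>\<^sub>1 (X i) \<and> spectral_gap_on M \<Lambda>\<^sub>1 (X i)) \<and>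
             (\<forall>i \<in> {1..n}. \<forall>j \<in> {1..n}. i \<noteq> j \<longrightarrow> measure M (X i \<inter> X j) = 0) \<and>
             measure M (space M - (\<Union>i \<in> {1..n}. X i)) = 0)"
proof -
  have law: "aut_law M L" if "borel_prob_on_Aut M L" for L
    using assms(1) that
    by (simp add: aut_law_def aut_law_axioms_def standard_borel_prob_space_def borel_prob_on_Aut_def)
  interpret L: aut_law M \<Lambda> by (rule law[OF assms(2)])
  interpret L1: aut_law M \<Lambda>\<^sub>1 by (rule law[OF assms(3)])
  interpret L2: aut_law M \<Lambda>\<^sub>2 by (rule law[OF assms(4)])
  let ?\<mu> = "measure M" and ?e = "expansion M \<Lambda>\<^sub>1"
  note \<kappa> = assms(6-8)
  have \<rho>: "0 < 1 - \<rho>" "0 < \<kappa> - \<rho>" using \<kappa> by simp_all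
  have key: "?\<mu> A * ((\<kappa> - \<rho>) - (1 - \<rho>) * ?\<mu> A) \<le> \<kappa> * ?e A" if A: "A \<in> sets M" for A
  proof -
    have "(1 - \<rho>) * (?\<mu> A * (1 - ?\<mu> A)) \<le> expansion M \<Lambda> A"
      using L.expansion_ge[OF A] assms(5) by simp
    also have "\<dots> = \<kappa> * ?e A + (1 - \<kappa>) * expansion M \<Lambda>\<^sub>2 A"
      using assms(9) \<kappa> by (intro expansion_mixture law assms A) auto
    also have "\<dots> \<le> \<kappa> * ?e A + (1 - \<kappa>) * ?\<mu> A"
      using L2.expansion_le[OF A] \<kappa> by (intro add_left_mono mult_left_mono) auto
    finally show ?thesis by (simp add: algebra_simps)
  qed
  have one: "(\<kappa> - \<rho>) / (1 - \<rho>) \<le> ?\<mu> Y" if "invariant_set M \<Lambda>\<^sub>1 Y" "0 < ?\<mu> Y" for Y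
  proof -
    have "?\<mu> Y * ((\<kappa> - \<rho>) - (1 - \<rho>) * ?\<mu> Y) \<le> 0"
      using key[of Y] that(1) by (simp add: invariant_set_def)
    then have "(\<kappa> - \<rho>) - (1 - \<rho>) * ?\<mu> Y \<le> 0"
      using that(2) by (simp add: mult_le_0_iff)
    then show ?thesis using \<rho> by (simp add: divide_le_eq mult.commute)
  qed
  have two: "(\<kappa> - \<rho>) / 2 * ?\<mu> Y \<le> \<kappa> * ?e Y"
    if "Y \<in> sets M" "?\<mu> Y \<le> 1/2 * ((\<kappa> - \<rho>) / (1 - \<rho>))" for Y
  proof -
    have "(1 - \<rho>) * ?\<mu> Y \<le> (1 - \<rho>) * (1/2 * ((\<kappa> - \<rho>) / (1 - \<rho>)))"
      using that(2) \<rho> by (intro mult_left_mono) auto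
    also have "\<dots> = (\<kappa> - \<rho>) / 2"
    proof -
      have "r * (1/2 * (q / r)) = q / 2" if "0 < r" for q r :: real using that by simp
      then show ?thesis using \<rho>(1) .
    qed
    finally have "?\<mu> Y * ((\<kappa> - \<rho>) / 2) \<le> ?\<mu> Y * ((\<kappa> - \<rho>) - (1 - \<rho>) * ?\<mu> Y)"
      by (intro mult_left_mono) auto
    then show ?thesis using key[OF that(1)] by (simp add: mult.commute)
  qed
  \<comment> \<open>The threshold and the constant \<open>2 * \<kappa> / (\<kappa> - \<rho>)\<close>
    are those of \<open>two\<close>, solved for the measure.\<close>
  have gap: "spectral_gap_on M \<Lambda>\<^sub>1 Y" if "ergodic_set M \<Lambda>\<^sub>1 Y" "0 < ?\<mu> Y" for Y
  proof (rule L1.ergodic_spectral_gap[OF that, of "1/2 * ((\<kappa> - \<rho>) / (1 - \<rho>))" "2 * \<kappa> / (\<kappa> - \<rho>)"])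
    fix A assume "A \<in> sets M" "?\<mu> A \<le> 1/2 * ((\<kappa> - \<rho>) / (1 - \<rho>))"
    from two[OF this] show "?\<mu> A \<le> 2 * \<kappa> / (\<kappa> - \<rho>) * ?e A"
      using \<rho> by (simp add: field_simps)
  qed (use \<rho> \<kappa> in auto)
  obtain \<X> where X: "finite \<X>" "disjoint \<X>" "\<Union>\<X> = space M"
    "\<forall>Z\<in>\<X>. ergodic_set M \<Lambda>\<^sub>1 Z \<and> 0 < ?\<mu> Z"
    using L1.ergodic_decomposition[OF _ one L1.invariant_space] \<rho> by (auto simp: L.prob_space)
  have X_sets: "Z \<in> sets M" if "Z \<in> \<X>" for Z
    using X(4) that by (auto simp: ergodic_set_def invariant_set_def)
  \<comment> \<open>The pieces are disjoint, each has at least the measure in \<open>one\<close>,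
    and together they have measure 1.\<close>
  have "card \<X> * ((\<kappa> - \<rho>) / (1 - \<rho>)) = (\<Sum>Z\<in>\<X>. (\<kappa> - \<rho>) / (1 - \<rho>))" by simp
  also have "\<dots> \<le> (\<Sum>Z\<in>\<X>. ?\<mu> Z)"
    using X(4) by (intro sum_mono one) (auto simp: ergodic_set_def)
  also have "\<dots> = ?\<mu> (\<Union>Z\<in>\<X>. Z)"
    using X(1,2) X_sets
    by (intro L.finite_measure_finite_Union[symmetric]) (auto simp: disjoint_family_on_def disjoint_def pairwise_def disjnt_def)
  also have "\<dots> = 1" using X(3) by (simp add: L.prob_space)
  finally have card: "card \<X> \<le> (1 - \<rho>) / (\<kappa> - \<rho>)"
    using \<rho> by (simp add: field_simps)
  obtain h where h: "bij_betw h {1..card \<X>} \<X>"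
    using ex_bij_betw_nat_finite_1[OF X(1)] by blast
  have h_in: "h i \<in> \<X>" if "i \<in> {1..card \<X>}" for i using h that by (auto simp: bij_betw_def)
  have h_disj: "h i \<inter> h j = {}" if "i \<in> {1..card \<X>}" "j \<in> {1..card \<X>}" "i \<noteq> j" for i j
    using X(2) h_in that h by (metis bij_betw_def disjointD inj_onD)
  have h_Un: "(\<Union>i\<in>{1..card \<X>}. h i) = space M" using h X(3) by (simp add: bij_betw_def)
  have "\<exists>(n::nat) (X :: nat \<Rightarrow> 'a set). real n \<le> (1 - \<rho>) / (\<kappa> - \<rho>) \<and>
      (\<forall>i \<in> {1..n}. X i \<in> sets M \<and> ?\<mu> (X i) > 0 \<and>
         ergodic_set M \<Lambda>\<^sub>1 (X i) \<and> spectral_gap_on M \<Lambda>\<^sub>1 (X i)) \<and>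
      (\<forall>i \<in> {1..n}. \<forall>j \<in> {1..n}. i \<noteq> j \<longrightarrow> ?\<mu> (X i \<inter> X j) = 0) \<and>
      ?\<mu> (space M - (\<Union>i \<in> {1..n}. X i)) = 0"
    using card h_in X(4) X_sets gap h_disj h_Un
    by (intro exI[of _ "card \<X>"] exI[of _ h] conjI ballI impI) auto
  moreover have "1/2 * ((\<kappa> - \<rho>) / \<kappa>) \<le> ?e Y / ?\<mu> Y"
    if "Y \<in> sets M" "0 < ?\<mu> Y" "?\<mu> Y \<le> 1/2 * ((\<kappa> - \<rho>) / (1 - \<rho>))" for Y
    using two[OF that(1,3)] that(2) \<kappa>(1) by (simp add: field_simps)
  ultimately show ?thesis using one by blast
qed

end
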